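(* Let $G$ be an ordered abelian group with bounded regular rank. Then $G$ admits quantifier elimination in the language $$L=\{+,-,0,\le\}\cup\{1_\Delta : \Delta\in\mathrm{RJ}(G),\ G/\Delta\text{ discrete}\}\cup\{x\equiv y \bmod \Delta : \Delta\in\mathrm{RJ}(G)\}\cup\{x\equiv y \bmod (\Delta+p^mG): p\text{ prime},\ \Delta\in\mathrm{RJ}_p(G),\ m\ge1\},$$ where each $1_\Delta$ is a constant interpreted as an element of $G$ whose image in $G/\Delta$ is the smallest positive element of $G/\Delta$, and $x\equiv y\bmod H$ is the binary relation $x-y\in H$.
   Context: An ordered abelian group (OAG) is an abelian group with a translation-invariant linear order. For $n\ge 2$, an OAG $H$ is $n$-regular if $H/C$ is $n$-divisible for every convex subgroup $C\neq\{0\}$ of $H$. For $g\in G\setminus\{0\}$, $B(g)$ is the smallest convex subgroup of $G$ containing $g$ and $A_n(g)$ is the smallest convex subgroup $C\subseteq B(g)$ of $G$ such that $B(g)/C$ is $n$-regular. $\mathrm{RJ}_n(G)=\{A_n(g): g\in G\setminus\{0\}\}$ and $\mathrm{RJ}(G)=\bigcup_{n\ge2}\mathrm{RJ}_n(G)$. $G$ has bounded regular rank if $\mathrm{RJ}_p(G)$ is finite for every prime $p$. *)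

theory Defs
  imports "HOL-Algebra.Coset" "HOL-Computational_Algebra.Primes"
begin

text \<open>
  The ambient ordered abelian group \<open>G\<close> is a type of class \<open>linordered_ab_group_add\<close>. Its convex
  subgroups and their quotients are again ordered abelian groups but not types, so the notions of
  the theory of ordered groups are stated for group records carrying an order. As usual in
  HOL-Algebra, groups are written multiplicatively there: \<open>x [^] n\<close> is the multiple \<open>n x\<close> and
  \<open>\<one>\<close> is the neutral element \<open>0\<close>.
\<close>

record 'a ord_group = "'a monoid" +
  oleq :: "'a \<Rightarrow> 'a \<Rightarrow> bool"

definition oag :: "'a::linordered_ab_group_add ord_group" where
  "oag = \<lparr>carrier = UNIV, monoid.mult = (+), one = 0, oleq = (\<le>)\<rparr>"

definition convex_subgroup :: "'a set \<Rightarrow> 'a ord_group \<Rightarrow> bool" where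
  "convex_subgroup C G \<longleftrightarrow>
     subgroup C G \<and>
     (\<forall>x\<in>C. \<forall>z\<in>C. \<forall>y\<in>carrier G. oleq G x y \<and> oleq G y z \<longrightarrow> y \<in> C)"

text \<open>
  The quotient by a convex subgroup. The order is the image of the order of \<open>G\<close>, which for convex
  \<open>C\<close> makes the projection monotone and the quotient an ordered group.
\<close>

definition oquot :: "'a ord_group \<Rightarrow> 'a set \<Rightarrow> 'a set ord_group" where
  "oquot G C =
     \<lparr>carrier = carrier (G Mod C), monoid.mult = monoid.mult (G Mod C), one = one (G Mod C),
      oleq = (\<lambda>X Y. \<exists>x\<in>X. \<exists>y\<in>Y. oleq G x y)\<rparr>"

definition n_divisible :: "nat \<Rightarrow> 'a ord_group \<Rightarrow> bool" where
  "n_divisible n G \<longleftrightarrow> (\<forall>x\<in>carrier G. \<exists>y\<in>carrier G. x = y [^]\<^bsub>G\<^esub> n)"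

definition n_regular :: "nat \<Rightarrow> 'a ord_group \<Rightarrow> bool" where
  "n_regular n G \<longleftrightarrow>
     (\<forall>C. convex_subgroup C G \<and> C \<noteq> {\<one>\<^bsub>G\<^esub>} \<longrightarrow> n_divisible n (oquot G C))"

definition least_positive :: "'a ord_group \<Rightarrow> 'a \<Rightarrow> bool" where
  "least_positive G x \<longleftrightarrow>
     x \<in> carrier G \<and> oleq G \<one>\<^bsub>G\<^esub> x \<and> x \<noteq> \<one>\<^bsub>G\<^esub> \<and>
     (\<forall>y\<in>carrier G. oleq G \<one>\<^bsub>G\<^esub> y \<and> y \<noteq> \<one>\<^bsub>G\<^esub> \<longrightarrow> oleq G x y)"

definition discrete_group :: "'a ord_group \<Rightarrow> bool" where
  "discrete_group G \<longleftrightarrow> (\<exists>x. least_positive G x)"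

text \<open>In the next two definitions \<open>LEAST\<close> refers to inclusion of sets; both least elements exist.\<close>

definition B_sub :: "'a ord_group \<Rightarrow> 'a \<Rightarrow> 'a set" where
  "B_sub G g = (LEAST C. convex_subgroup C G \<and> g \<in> C)"

definition A_sub :: "nat \<Rightarrow> 'a ord_group \<Rightarrow> 'a \<Rightarrow> 'a set" where
  "A_sub n G g =
     (LEAST C. convex_subgroup C G \<and> C \<subseteq> B_sub G g \<and>
               n_regular n (oquot (G\<lparr>carrier := B_sub G g\<rparr>) C))"

definition RJn :: "nat \<Rightarrow> 'a ord_group \<Rightarrow> 'a set set" where
  "RJn n G = {A_sub n G g | g. g \<in> carrier G \<and> g \<noteq> \<one>\<^bsub>G\<^esub>}"

definition RJ :: "'a ord_group \<Rightarrow> 'a set set" where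
  "RJ G = (\<Union>n\<in>{2..}. RJn n G)"

definition bounded_regular_rank :: "'a ord_group \<Rightarrow> bool" where
  "bounded_regular_rank G \<longleftrightarrow> (\<forall>p::nat. prime p \<longrightarrow> finite (RJn p G))"

text \<open>
  Raw first-order syntax. Symbols are indexed by arbitrary sets \<open>\<Delta>\<close> and numbers \<open>p, m\<close>; the
  predicates \<open>L_term\<close> and \<open>L_formula\<close> below restrict the indices to those of the language.
  The remaining connectives and the universal quantifier are definable.
\<close>

datatype 'a tm =
    Var nat
  | Zero
  | Plus "'a tm" "'a tm"
  | Minus "'a tm"
  | One "'a set"

datatype 'a fm =
    Eq "'a tm" "'a tm"
  | Le "'a tm" "'a tm"
  | Cong "'a set" "'a tm" "'a tm"
  | CongPow "'a set" nat nat "'a tm" "'a tm"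
  | Neg "'a fm"
  | Conj "'a fm" "'a fm"
  | Ex nat "'a fm"

primrec L_term :: "'a::linordered_ab_group_add tm \<Rightarrow> bool" where
  "L_term (Var i) \<longleftrightarrow> True"
| "L_term Zero \<longleftrightarrow> True"
| "L_term (Plus s t) \<longleftrightarrow> L_term s \<and> L_term t"
| "L_term (Minus t) \<longleftrightarrow> L_term t"
| "L_term (One \<Delta>) \<longleftrightarrow> \<Delta> \<in> RJ oag \<and> discrete_group (oquot oag \<Delta>)"

primrec L_formula :: "'a::linordered_ab_group_add fm \<Rightarrow> bool" where
  "L_formula (Eq s t) \<longleftrightarrow> L_term s \<and> L_term t"
| "L_formula (Le s t) \<longleftrightarrow> L_term s \<and> L_term t"
| "L_formula (Cong \<Delta> s t) \<longleftrightarrow> \<Delta> \<in> RJ oag \<and> L_term s \<and> L_term t"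
| "L_formula (CongPow \<Delta> p m s t) \<longleftrightarrow>
     prime p \<and> \<Delta> \<in> RJn p oag \<and> m \<ge> 1 \<and> L_term s \<and> L_term t"
| "L_formula (Neg \<phi>) \<longleftrightarrow> L_formula \<phi>"
| "L_formula (Conj \<phi> \<psi>) \<longleftrightarrow> L_formula \<phi> \<and> L_formula \<psi>"
| "L_formula (Ex i \<phi>) \<longleftrightarrow> L_formula \<phi>"

primrec tm_vars :: "'a tm \<Rightarrow> nat set" where
  "tm_vars (Var i) = {i}"
| "tm_vars Zero = {}"
| "tm_vars (Plus s t) = tm_vars s \<union> tm_vars t"
| "tm_vars (Minus t) = tm_vars t"
| "tm_vars (One \<Delta>) = {}"

primrec free_vars :: "'a fm \<Rightarrow> nat set" where
  "free_vars (Eq s t) = tm_vars s \<union> tm_vars t"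
| "free_vars (Le s t) = tm_vars s \<union> tm_vars t"
| "free_vars (Cong \<Delta> s t) = tm_vars s \<union> tm_vars t"
| "free_vars (CongPow \<Delta> p m s t) = tm_vars s \<union> tm_vars t"
| "free_vars (Neg \<phi>) = free_vars \<phi>"
| "free_vars (Conj \<phi> \<psi>) = free_vars \<phi> \<union> free_vars \<psi>"
| "free_vars (Ex i \<phi>) = free_vars \<phi> - {i}"

primrec quantifier_free :: "'a fm \<Rightarrow> bool" where
  "quantifier_free (Eq s t) \<longleftrightarrow> True"
| "quantifier_free (Le s t) \<longleftrightarrow> True"
| "quantifier_free (Cong \<Delta> s t) \<longleftrightarrow> True"
| "quantifier_free (CongPow \<Delta> p m s t) \<longleftrightarrow> True"
| "quantifier_free (Neg \<phi>) \<longleftrightarrow> quantifier_free \<phi>"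
| "quantifier_free (Conj \<phi> \<psi>) \<longleftrightarrow> quantifier_free \<phi> \<and> quantifier_free \<psi>"
| "quantifier_free (Ex i \<phi>) \<longleftrightarrow> False"

text \<open>The argument \<open>c\<close> interprets the constants: \<open>c \<Delta>\<close> is the value of the constant for \<open>\<Delta>\<close>.\<close>

primrec tm_val ::
  "('a set \<Rightarrow> 'a::linordered_ab_group_add) \<Rightarrow> (nat \<Rightarrow> 'a) \<Rightarrow> 'a tm \<Rightarrow> 'a" where
  "tm_val c e (Var i) = e i"
| "tm_val c e Zero = 0"
| "tm_val c e (Plus s t) = tm_val c e s + tm_val c e t"
| "tm_val c e (Minus t) = - tm_val c e t"
| "tm_val c e (One \<Delta>) = c \<Delta>"

primrec sat ::
  "('a set \<Rightarrow> 'a::linordered_ab_group_add) \<Rightarrow> (nat \<Rightarrow> 'a) \<Rightarrow> 'a fm \<Rightarrow> bool" where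
  "sat c e (Eq s t) \<longleftrightarrow> tm_val c e s = tm_val c e t"
| "sat c e (Le s t) \<longleftrightarrow> tm_val c e s \<le> tm_val c e t"
| "sat c e (Cong \<Delta> s t) \<longleftrightarrow> tm_val c e s - tm_val c e t \<in> \<Delta>"
| "sat c e (CongPow \<Delta> p m s t) \<longleftrightarrow>
     tm_val c e s - tm_val c e t \<in> {d + z [^]\<^bsub>oag\<^esub> (p ^ m) | d z. d \<in> \<Delta>}"
| "sat c e (Neg \<phi>) \<longleftrightarrow> \<not> sat c e \<phi>"
| "sat c e (Conj \<phi> \<psi>) \<longleftrightarrow> sat c e \<phi> \<and> sat c e \<psi>"
| "sat c e (Ex i \<phi>) \<longleftrightarrow> (\<exists>x. sat c (e(i := x)) \<phi>)"

definition interprets_constants :: "('a set \<Rightarrow> 'a::linordered_ab_group_add) \<Rightarrow> bool" where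
  "interprets_constants c \<longleftrightarrow>
     (\<forall>\<Delta>\<in>RJ oag. discrete_group (oquot oag \<Delta>) \<longrightarrow>
        least_positive (oquot oag \<Delta>) (\<Delta> #>\<^bsub>oag\<^esub> c \<Delta>))"

definition admits_QE :: "('a set \<Rightarrow> 'a::linordered_ab_group_add) \<Rightarrow> bool" where
  "admits_QE c \<longleftrightarrow>
     (\<forall>\<phi>. L_formula \<phi> \<longrightarrow>
        (\<exists>\<psi>. L_formula \<psi> \<and> quantifier_free \<psi> \<and> free_vars \<psi> \<subseteq> free_vars \<phi> \<and>
             (\<forall>e. sat c e \<phi> \<longleftrightarrow> sat c e \<psi>)))"

end

theory Submission imports Defs begin

text \<open>
  Quantifiers are eliminated semantically. For a finite set \<open>F\<close> of atoms and a variable \<open>i\<close> there is a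
  finite set \<open>F'\<close> of atoms without \<open>i\<close> such that whenever two assignments agree on \<open>F'\<close>, every value
  of \<open>i\<close> in the first is matched by a value in the second, with agreement on \<open>F\<close>.

  After clearing coefficients, let \<open>x\<close> be compared with finitely many parameters \<open>t\<close>, and let \<open>E\<close> be
  the least relevant convex subgroup with \<open>x \<in> t + E\<close> for some \<open>t\<close>, \<open>D\<close> its predecessor. For each
  prime \<open>p\<close> the congruences modulo \<open>\<Delta> + p\<^sup>m G\<close> with \<open>\<Delta> \<in> RJ\<^sub>p\<close> are solved from the largest \<open>\<Delta>\<close>
  downwards; negated congruences are satisfied by counting classes. The Chinese remainder theorem
  combines the primes. Since \<open>E/D\<close> is regular, an interval of length \<open>n \<epsilon>\<close> with
  \<open>\<epsilon> \<in> E - D\<close> meets every class of \<open>E\<close> modulo \<open>n E\<close>, so the solution can be moved into the order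
  position of \<open>x\<close>; the interval can only be too short if \<open>E/D\<close> is discrete and \<open>x\<close> is congruent
  modulo \<open>D\<close> to some \<open>t + j 1\<^sub>D\<close> with \<open>j\<close> bounded, which the choice of \<open>E\<close> excludes.
\<close>

section \<open>Multiples and convex subgroups\<close>

text \<open>Clearing coefficients replaces \<open>x\<close> by \<open>N x\<close>, so the matching
  point must again be divisible by \<open>N\<close>. This is a condition of the language: in a
  nontrivial \<open>G\<close>, finiteness puts \<open>{0}\<close> into every \<open>RJ_p\<close>, so
  divisibility by \<open>N\<close> is a matter of congruences modulo \<open>{0} + p^m G\<close>.

  The main obstacle is discreteness. If \<open>E/D\<close> is discrete, the gap between two
  parameters may be shorter than the modulus \<open>n\<close>, and a solution of the congruences
  need not fit into it. Therefore the parameters are enlarged by all \<open>t + j 1_D\<close> with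
  \<open>j \<le> n + 2\<close>, and \<open>E\<close> is chosen over the enlarged set. The summand 2
  is a margin of one step at each end of the interval, which keeps the new point away from the
  parameters modulo \<open>D\<close>.

  A second obstacle is that \<open>E\<close> need not belong to \<open>RJ_p\<close>, so congruences
  modulo \<open>E + p^m G\<close> may be missing from the language. They coincide with those of the
  next larger member of \<open>RJ_p\<close>, because the layer in between is p-divisible.

  No saturation or compactness enters: a property that is invariant under agreement on a finite set
  of formulas is a Boolean combination of them.\<close>

primrec nmul :: "nat \<Rightarrow> 'a::ab_group_add \<Rightarrow> 'a" where
  "nmul 0 x = 0"
| "nmul (Suc n) x = x + nmul n x"

lemma nmul_1 [simp]: "nmul (Suc 0) x = x" "nmul 1 x = x" by simp_all
lemma nmul_0_right [simp]: "nmul n 0 = 0" by (induction n) auto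
lemma nmul_add_left: "nmul (m + n) x = nmul m x + nmul n x" by (induction m) (auto simp: algebra_simps)
lemma nmul_add: "nmul n (x + y) = nmul n x + nmul n y" by (induction n) (auto simp: algebra_simps)
lemma nmul_minus: "nmul n (- x) = - nmul n x" by (induction n) (auto simp: algebra_simps)
lemma nmul_diff: "nmul n (x - y) = nmul n x - nmul n y"
  using nmul_add[of n x "- y"] by (simp add: nmul_minus)
lemma nmul_mult: "nmul (m * n) x = nmul m (nmul n x)" by (induction m) (auto simp: nmul_add_left)
lemma nmul_commute: "nmul m (nmul n x) = nmul n (nmul m x)" by (metis mult.commute nmul_mult)

lemma nmul_mono: "x \<le> y \<Longrightarrow> nmul n x \<le> nmul n (y::'a::linordered_ab_group_add)"
  by (induction n) (auto intro: add_mono)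
lemma nmul_nonneg: "0 \<le> x \<Longrightarrow> 0 \<le> nmul n (x::'a::linordered_ab_group_add)"
  using nmul_mono[of 0 x n] by simp
lemma nmul_mono_left: "0 \<le> x \<Longrightarrow> m \<le> n \<Longrightarrow> nmul m x \<le> nmul n (x::'a::linordered_ab_group_add)"
  by (metis add.right_neutral add_left_mono le_iff_add nmul_add_left nmul_nonneg)
lemma nmul_ge_self: "0 \<le> x \<Longrightarrow> 0 < n \<Longrightarrow> x \<le> nmul n (x::'a::linordered_ab_group_add)"
  using nmul_mono_left[of x 1 n] by simp
lemma nmul_strict_mono: "0 < n \<Longrightarrow> x < y \<Longrightarrow> nmul n x < nmul n (y::'a::linordered_ab_group_add)"
proof (induction n)
  case (Suc n) then show ?case by (cases n) (auto intro: add_strict_mono)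
qed simp
lemma nmul_le_iff: "0 < n \<Longrightarrow> nmul n x \<le> nmul n y \<longleftrightarrow> x \<le> (y::'a::linordered_ab_group_add)"
  using nmul_mono nmul_strict_mono by (metis linorder_not_less)

definition subgrp :: "'a::ab_group_add set \<Rightarrow> bool" where
  "subgrp D \<longleftrightarrow> 0 \<in> D \<and> (\<forall>x\<in>D. \<forall>y\<in>D. x + y \<in> D) \<and> (\<forall>x\<in>D. - x \<in> D)"

text \<open>Convexity is asked only on intervals starting at 0; translating by an endpoint recovers
  it between any two elements.\<close>

definition convex_subgrp :: "'a::linordered_ab_group_add set \<Rightarrow> bool" where
  "convex_subgrp D \<longleftrightarrow> subgrp D \<and> (\<forall>x\<in>D. \<forall>y. 0 \<le> y \<and> y \<le> x \<longrightarrow> y \<in> D)"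

lemma subgrpD:
  assumes "subgrp D"
  shows "0 \<in> D" "x \<in> D \<Longrightarrow> y \<in> D \<Longrightarrow> x + y \<in> D" "x \<in> D \<Longrightarrow> - x \<in> D"
    "x \<in> D \<Longrightarrow> y \<in> D \<Longrightarrow> x - y \<in> D"
  using assms unfolding subgrp_def by (auto, metis diff_conv_add_uminus)

lemma subgrp_nmul: "subgrp D \<Longrightarrow> x \<in> D \<Longrightarrow> nmul n x \<in> D"
  by (induction n) (auto simp: subgrp_def)

lemma subgrp_diff_commute: "subgrp D \<Longrightarrow> x - y \<in> D \<longleftrightarrow> y - x \<in> D"
  by (metis minus_diff_eq subgrpD(3))

lemma subgrp_shift:
  assumes "subgrp D" "x - y \<in> D" shows "x - z \<in> D \<longleftrightarrow> y - z \<in> D"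
proof -
  have "x - z = (x - y) + (y - z)" "y - z = (x - z) - (x - y)" by simp_all
  then show ?thesis using assms subgrpD by metis
qed

lemma convex_subgrp_subgrp: "convex_subgrp D \<Longrightarrow> subgrp D"
  by (simp add: convex_subgrp_def)

lemma convex_subgrpD: "convex_subgrp D \<Longrightarrow> x \<in> D \<Longrightarrow> 0 \<le> y \<Longrightarrow> y \<le> x \<Longrightarrow> y \<in> D"
  by (auto simp: convex_subgrp_def)

text \<open>\<open>max x (- x)\<close> plays the role of the absolute value, so that bounds can be
  argued for nonnegative elements.\<close>

lemma convex_subgrp_max: "convex_subgrp D \<Longrightarrow> max x (- x) \<in> D \<longleftrightarrow> x \<in> D"
  unfolding convex_subgrp_def subgrp_def max_def by (metis minus_minus)

lemma max_minus_nonneg: "0 \<le> max x (- x)" for x :: "'a::linordered_ab_group_add"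
  by (cases "0 \<le> x") (auto simp: le_max_iff_disj)

text \<open>For x \<ge> 0 the element lies between 0 and \<open>nmul n x\<close>. Thus quotients by
  convex subgroups are torsion-free, which allows factors to be cancelled in congruences.\<close>

lemma convex_subgrp_pure:
  assumes "convex_subgrp D" "nmul n x \<in> D" "0 < n" shows "x \<in> D"
proof -
  have s: "subgrp D" using assms convex_subgrp_subgrp by blast
  show ?thesis
  proof (cases "0 \<le> x")
    case True
    then show ?thesis using assms nmul_ge_self convex_subgrpD by blast
  next
    case False
    then have "- x \<le> nmul n (- x)" using nmul_ge_self[of "- x" n] assms by simp
    then have "- x \<in> D" using False assms s convex_subgrpD[of D "nmul n (- x)" "- x"]
      by (auto simp: nmul_minus subgrpD)
    then show ?thesis using s subgrpD(3) by fastforce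
  qed
qed

lemma convex_subgrp_between:
  assumes "convex_subgrp D" "a \<in> D" "b \<in> D" "a \<le> x" "x \<le> b" shows "x \<in> D"
proof -
  have "b - a \<in> D" using assms convex_subgrp_subgrp subgrpD by blast
  then have "x - a \<in> D" using assms convex_subgrpD[of D "b - a" "x - a"] by simp
  then show ?thesis using assms(2) subgrpD(2)[OF convex_subgrp_subgrp[OF assms(1)], of "x - a" a] by simp
qed

text \<open>If x lies only in C and y only in D, the smaller of the two absolute values lies in
  both. The later choices of least and greatest subgroups rest on this.\<close>

lemma convex_subgrp_linear:
  assumes "convex_subgrp C" "convex_subgrp D" shows "C \<subseteq> D \<or> D \<subseteq> C"
proof (rule ccontr)
  assume "\<not> ?thesis"
  then obtain x y where "x \<in> C" "x \<notin> D" "y \<in> D" "y \<notin> C" by auto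
  then have "max x (-x) \<in> C" "max x (-x) \<notin> D" "max y (-y) \<in> D" "max y (-y) \<notin> C"
    using assms convex_subgrp_max by blast+
  then show False
    using assms convex_subgrpD max_minus_nonneg by (metis linorder_linear)
qed

lemma convex_subgrp_zero [simp]: "convex_subgrp {0}"
  by (auto simp: convex_subgrp_def subgrp_def)
lemma convex_subgrp_UNIV [simp]: "convex_subgrp UNIV"
  by (auto simp: convex_subgrp_def subgrp_def)

text \<open>The explicit form of B(g). The bounding multiple is what division with remainder in
  intervals needs.\<close>

definition conv_hull :: "'a::linordered_ab_group_add \<Rightarrow> 'a set" where
  "conv_hull g = {z. \<exists>k. max z (- z) \<le> nmul k (max g (- g))}"

lemma convex_subgrp_conv_hull: "convex_subgrp (conv_hull g)"
proof -
  let ?G = "max g (- g)"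
  have "x + y \<in> conv_hull g" if xy: "x \<in> conv_hull g" "y \<in> conv_hull g" for x y
  proof -
    obtain j k where "max x (- x) \<le> nmul j ?G" "max y (- y) \<le> nmul k ?G"
      using xy by (auto simp: conv_hull_def)
    then have "x + y \<le> nmul j ?G + nmul k ?G" "- x + - y \<le> nmul j ?G + nmul k ?G"
      using add_mono[of x "nmul j ?G" y "nmul k ?G"] add_mono[of "-x" "nmul j ?G" "-y" "nmul k ?G"]
      by (auto simp only: max.bounded_iff)
    then have "max (x + y) (- (x + y)) \<le> nmul (j + k) ?G"
      by (auto simp: nmul_add_left)
    then show ?thesis by (auto simp: conv_hull_def simp del: max.bounded_iff)
  qed
  moreover have "0 \<in> conv_hull g" by (auto simp: conv_hull_def intro: exI[of _ 0])
  moreover have "- x \<in> conv_hull g" if "x \<in> conv_hull g" for x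
    using that by (simp add: conv_hull_def conj_commute)
  moreover have "y \<in> conv_hull g" if "x \<in> conv_hull g" "0 \<le> y" "y \<le> x" for x y
  proof -
    obtain k where "x \<le> nmul k ?G" using \<open>x \<in> conv_hull g\<close> by (auto simp: conv_hull_def)
    then have "max y (- y) \<le> nmul k ?G" using that by (auto intro: order_trans)
    then show ?thesis by (auto simp: conv_hull_def simp del: max.bounded_iff)
  qed
  ultimately show ?thesis by (auto simp: convex_subgrp_def subgrp_def)
qed

lemma conv_hull_self: "g \<in> conv_hull g"
  unfolding conv_hull_def by (metis (mono_tags, lifting) mem_Collect_eq nmul_1(2) order_refl)

lemma conv_hull_least:
  assumes "convex_subgrp C" "g \<in> C" shows "conv_hull g \<subseteq> C"
proof
  fix z assume "z \<in> conv_hull g"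
  then obtain k where "max z (- z) \<le> nmul k (max g (- g))" by (auto simp: conv_hull_def)
  moreover have "nmul k (max g (- g)) \<in> C"
    using assms by (simp add: convex_subgrp_max convex_subgrp_subgrp subgrp_nmul)
  ultimately have "max z (- z) \<in> C" using convex_subgrpD[OF assms(1)] max_minus_nonneg by blast
  then show "z \<in> C" using assms(1) convex_subgrp_max by blast
qed

section \<open>Subgroups \<open>D + kG\<close>\<close>

definition cong_grp :: "'a::ab_group_add set \<Rightarrow> nat \<Rightarrow> 'a set" where
  "cong_grp D k = {d + nmul k z | d z. d \<in> D}"

lemma cong_grpI: "d \<in> D \<Longrightarrow> x = d + nmul k z \<Longrightarrow> x \<in> cong_grp D k"
  by (auto simp: cong_grp_def)

lemma cong_grpE:
  assumes "x \<in> cong_grp D k" obtains d z where "d \<in> D" "x = d + nmul k z"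
  using assms unfolding cong_grp_def by blast

lemma subgrp_cong_grp:
  assumes "subgrp D" shows "subgrp (cong_grp D k)"
proof -
  have "x + y \<in> cong_grp D k" if xy: "x \<in> cong_grp D k" "y \<in> cong_grp D k" for x y
  proof -
    obtain d z d' z' where "d \<in> D" "x = d + nmul k z" "d' \<in> D" "y = d' + nmul k z'"
      using xy by (meson cong_grpE)
    then show ?thesis using assms
      by (intro cong_grpI[of "d + d'" _ _ _ "z + z'"]) (auto simp: nmul_add subgrpD algebra_simps)
  qed
  moreover have "- x \<in> cong_grp D k" if x: "x \<in> cong_grp D k" for x
  proof -
    obtain d z where "d \<in> D" "x = d + nmul k z" using x by (meson cong_grpE)
    then show ?thesis using assms
      by (intro cong_grpI[of "- d" _ _ _ "- z"]) (auto simp: nmul_minus subgrpD algebra_simps)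
  qed
  moreover have "0 \<in> cong_grp D k" using assms by (intro cong_grpI[of 0 _ _ _ 0]) (auto simp: subgrpD)
  ultimately show ?thesis by (auto simp: subgrp_def)
qed

lemma cong_grp_base: "d \<in> D \<Longrightarrow> d \<in> cong_grp D k"
  by (auto intro: cong_grpI[of d _ _ _ 0])
lemma cong_grp_mult: "subgrp D \<Longrightarrow> nmul k z \<in> cong_grp D k"
  by (auto intro: cong_grpI[of 0 _ _ _ z] simp: subgrpD)
lemma cong_grp_mono: "D \<subseteq> E \<Longrightarrow> cong_grp D k \<subseteq> cong_grp E k"
  by (auto simp: cong_grp_def)
lemma cong_grp_antimono: "j dvd k \<Longrightarrow> cong_grp D k \<subseteq> cong_grp D j"
  by (fastforce simp: cong_grp_def dvd_def nmul_mult)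
lemma cong_grp_1 [simp]: "subgrp D \<Longrightarrow> x \<in> cong_grp D 1" "subgrp D \<Longrightarrow> x \<in> cong_grp D (Suc 0)"
  by (auto intro: cong_grpI[of 0 _ _ _ x] simp: subgrpD)

text \<open>Subtraction of naturals is truncated, so Bezout yields a u - b v = 1 or b u - a v = 1;
  hence the two sign patterns.\<close>

lemma bezout_nmul:
  assumes "coprime a b" obtains u v where "x = nmul a (nmul u x) + nmul b (- nmul v x) \<or>
     x = nmul a (- nmul u x) + nmul b (nmul v x)"
proof -
  obtain d u v where "d dvd a" "d dvd b" "a * u - b * v = d \<or> b * u - a * v = d"
    using bezout1_nat by blast
  moreover from this have "d = 1" using assms by (simp add: coprime_def)
  ultimately have "a * u = b * v + 1 \<or> b * u = a * v + 1" by linarith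
  then show thesis
  proof
    assume "a * u = b * v + 1"
    then have "nmul a (nmul u x) = nmul b (nmul v x) + x"
      by (metis nmul_1(2) nmul_add_left nmul_mult)
    then show thesis using that[of u v] by (simp add: nmul_minus)
  next
    assume "b * u = a * v + 1"
    then have "nmul b (nmul u x) = nmul a (nmul v x) + x"
      by (metis nmul_1(2) nmul_add_left nmul_mult)
    then show thesis using that[of v u] by (simp add: nmul_minus)
  qed
qed

lemma coprime_decomp:
  assumes "coprime a b" "subgrp E" "x \<in> E"
  obtains y z where "y \<in> E" "z \<in> E" "x = nmul a y + nmul b z"
proof -
  obtain u v where "x = nmul a (nmul u x) + nmul b (- nmul v x) \<or>
     x = nmul a (- nmul u x) + nmul b (nmul v x)" by (rule bezout_nmul[OF assms(1)])
  then show thesis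
    using that assms subgrp_nmul[of E x] subgrpD(3)[of E] by blast
qed

lemma cong_grp_coprime_cancel:
  assumes "coprime b k" "subgrp D" "nmul b y \<in> cong_grp D k"
  shows "y \<in> cong_grp D k"
proof -
  have s: "subgrp (cong_grp D k)" using assms subgrp_cong_grp by blast
  obtain u v where "y = nmul b (nmul u y) + nmul k (- nmul v y) \<or>
     y = nmul b (- nmul u y) + nmul k (nmul v y)" by (rule bezout_nmul[OF assms(1)])
  moreover have "nmul b (nmul u y) \<in> cong_grp D k" 
    using subgrp_nmul[OF s assms(3), of u] by (simp add: nmul_commute)
  ultimately show ?thesis using subgrpD[OF s] cong_grp_mult[OF assms(2)] 
    by (metis nmul_minus)
qed

text \<open>The factor b prime to p is cancelled by Bezout, and \<open>p ^ a\<close> is cancelled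
  because G/D is torsion-free, at the price of raising the exponent by a. This is how congruences
  pass to multiplied atoms.\<close>

lemma cong_grp_scale:
  assumes "convex_subgrp D" "prime p" "\<not> p dvd b"
  shows "nmul (p ^ a * b) y \<in> cong_grp D (p ^ (m + a)) \<longleftrightarrow> y \<in> cong_grp D (p ^ m)"
proof
  have s: "subgrp D" using assms convex_subgrp_subgrp by blast
  have cop: "coprime b (p ^ m)" using assms
    by (metis coprime_commute coprime_power_right_iff prime_imp_coprime)
  assume "nmul (p ^ a * b) y \<in> cong_grp D (p ^ (m + a))"
  then obtain d z where "d \<in> D" "nmul (p ^ a * b) y = d + nmul (p ^ (m + a)) z" by (rule cong_grpE)
  then have "nmul (p ^ a) (nmul b y - nmul (p ^ m) z) = d"
    by (simp add: nmul_diff nmul_mult power_add nmul_commute)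
  then have "nmul b y - nmul (p ^ m) z \<in> D"
    using convex_subgrp_pure[OF assms(1)] \<open>d \<in> D\<close> assms(2) by (metis prime_gt_0_nat zero_less_power)
  then have "nmul b y \<in> cong_grp D (p ^ m)"
    by (intro cong_grpI[of "nmul b y - nmul (p ^ m) z" _ _ _ z]) auto
  then show "y \<in> cong_grp D (p ^ m)" using cong_grp_coprime_cancel[OF cop s] by blast
next
  have s: "subgrp D" using assms convex_subgrp_subgrp by blast
  assume "y \<in> cong_grp D (p ^ m)"
  then obtain d z where "d \<in> D" "y = d + nmul (p ^ m) z" by (rule cong_grpE)
  then show "nmul (p ^ a * b) y \<in> cong_grp D (p ^ (m + a))"
    using subgrp_nmul[OF s]
    by (intro cong_grpI[of "nmul (p ^ a * b) d" _ _ _ "nmul b z"])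
      (auto simp: nmul_add nmul_mult power_add nmul_commute)
qed

lemma nmul_pow_oag: "x [^]\<^bsub>oag\<^esub> n = nmul n (x::'a::linordered_ab_group_add)"
  by (induction n) (auto simp: oag_def nat_pow_def add.commute)

section \<open>Convex subgroups with regular quotient\<close>

lemma oag_simps:
  "carrier oag = UNIV" "x \<otimes>\<^bsub>oag\<^esub> y = x + y" "\<one>\<^bsub>oag\<^esub> = 0" "oleq oag x y \<longleftrightarrow> x \<le> y"
  for x y :: "'a::linordered_ab_group_add"
  by (simp_all add: oag_def)

lemma comm_group_oag: "comm_group (oag :: 'a::linordered_ab_group_add ord_group)"
proof (rule comm_groupI)
  fix x :: 'a
  show "\<exists>y\<in>carrier oag. y \<otimes>\<^bsub>oag\<^esub> x = \<one>\<^bsub>oag\<^esub>"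
    by (auto simp: oag_simps intro: exI[of _ "- x"])
qed (auto simp: oag_simps algebra_simps)

text \<open>Makes G itself the case B = \<open>UNIV\<close> of the results on quotients B/C.\<close>

lemma oag_UNIV: "oag\<lparr>carrier := UNIV\<rparr> = oag"
  by (simp add: oag_def)

lemma inv_oag: "inv\<^bsub>oag\<^esub> x = - (x::'a::linordered_ab_group_add)"
proof -
  interpret comm_group "oag :: 'a ord_group" by (rule comm_group_oag)
  show ?thesis by (rule inv_equality) (auto simp: oag_def)
qed

lemma subgroup_oag_iff: "subgroup C oag \<longleftrightarrow> subgrp (C :: 'a::linordered_ab_group_add set)"
  unfolding subgroup_def subgrp_def inv_oag by (auto simp: oag_def)

lemma convex_subgroup_oag_iff:
  "convex_subgroup C oag \<longleftrightarrow> convex_subgrp (C :: 'a::linordered_ab_group_add set)"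
proof
  assume C: "convex_subgroup C oag"
  then have s: "subgrp C" by (simp add: convex_subgroup_def subgroup_oag_iff)
  have "y \<in> C" if "x \<in> C" "0 \<le> y" "y \<le> x" for x y
    using C that subgrpD(1)[OF s] unfolding convex_subgroup_def oag_def ord_group.simps partial_object.simps
    by blast
  then show "convex_subgrp C" using s unfolding convex_subgrp_def by blast
next
  assume C: "convex_subgrp C"
  show "convex_subgroup C oag"
    unfolding convex_subgroup_def subgroup_oag_iff oag_simps
  proof (intro conjI ballI impI)
    show "y \<in> C" if "x \<in> C" "z \<in> C" "x \<le> y \<and> y \<le> z" for x y z
      using convex_subgrp_between[OF C that(1,2)] that(3) by blast
  qed (rule convex_subgrp_subgrp[OF C])
qed

lemma comm_group_oquot:
  assumes "comm_group H" "subgroup C H" shows "comm_group (oquot H C)"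
proof -
  interpret comm_group "H Mod C" using assms comm_group.abelian_FactGroup by blast
  show ?thesis
  proof (rule comm_groupI)
    fix x assume "x \<in> carrier (oquot H C)"
    then show "\<exists>y\<in>carrier (oquot H C). y \<otimes>\<^bsub>oquot H C\<^esub> x = \<one>\<^bsub>oquot H C\<^esub>"
      using l_inv_ex by (simp add: oquot_def)
  qed (use m_closed m_assoc m_comm one_closed l_one in \<open>simp_all add: oquot_def\<close>)
qed

text \<open>Replaces equality of cosets by membership of a difference, so that divisibility is
  tested on representatives.\<close>

lemma n_divisible_oquot:
  assumes "comm_group H" "subgroup C H"
  shows "n_divisible n (oquot H C) \<longleftrightarrow>
    (\<forall>x\<in>carrier H. \<exists>y\<in>carrier H. x \<otimes>\<^bsub>H\<^esub> inv\<^bsub>H\<^esub> (y [^]\<^bsub>H\<^esub> n) \<in> C)"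
proof -
  interpret H: comm_group H by fact
  interpret normal C H using assms H.normal_iff_subgroup by blast
  have car: "carrier (oquot H C) = (\<lambda>x. C #>\<^bsub>H\<^esub> x) ` carrier H"
    by (auto simp: oquot_def FactGroup_def RCOSETS_def)
  have pow2: "(C #>\<^bsub>H\<^esub> y) [^]\<^bsub>oquot H C\<^esub> n = C #>\<^bsub>H\<^esub> (y [^]\<^bsub>H\<^esub> n)" if "y \<in> carrier H" for y and n :: nat
  proof -
    have "(C #>\<^bsub>H\<^esub> y) [^]\<^bsub>oquot H C\<^esub> n = (C #>\<^bsub>H\<^esub> y) [^]\<^bsub>H Mod C\<^esub> n"
      by (simp add: nat_pow_def oquot_def)
    then show ?thesis using FactGroup_pow[OF that] by simp
  qed
  have eq: "C #>\<^bsub>H\<^esub> x = C #>\<^bsub>H\<^esub> y \<longleftrightarrow> x \<otimes>\<^bsub>H\<^esub> inv\<^bsub>H\<^esub> y \<in> C" if "x \<in> carrier H" "y \<in> carrier H" for x y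
    using that by (metis H.coset_join1 H.coset_join2 H.coset_mult_inv1 H.coset_mult_inv2 H.inv_closed H.m_closed subgroup_axioms subset)
  show ?thesis
    unfolding n_divisible_def car using pow2 eq by simp
qed

section \<open>The quotient B/C of convex subgroups, computed on representatives\<close>

context
  fixes B C :: "'a::linordered_ab_group_add set"
  assumes B: "convex_subgrp B" and C: "convex_subgrp C" and CB: "C \<subseteq> B"
begin

private abbreviation "H \<equiv> oag\<lparr>carrier := B\<rparr>"
private abbreviation "Q \<equiv> oquot H C"
private abbreviation "\<kappa> x \<equiv> C #>\<^bsub>oag\<^esub> x"

lemma comm_group_convex_subgrp: "comm_group H"
proof (rule comm_groupI)
  note sB = convex_subgrp_subgrp[OF B]
  fix x assume "x \<in> carrier H"
  then show "\<exists>y\<in>carrier H. y \<otimes>\<^bsub>H\<^esub> x = \<one>\<^bsub>H\<^esub>"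
    using subgrpD(3)[OF sB] by (auto simp: oag_simps intro!: bexI[of _ "- x"])
qed (use subgrpD[OF convex_subgrp_subgrp[OF B]] in \<open>auto simp: oag_simps algebra_simps\<close>)

lemma subgroup_convex_subgrp: "subgroup C H"
proof -
  interpret comm_group "oag :: 'a ord_group" by (rule comm_group_oag)
  show ?thesis using subgroup_incl[of C B] B C CB by (simp add: subgroup_oag_iff convex_subgrp_subgrp)
qed

lemma mem_coset_iff: "z \<in> \<kappa> x \<longleftrightarrow> z - x \<in> C"
proof -
  have "z \<in> \<kappa> x \<longleftrightarrow> (\<exists>c\<in>C. z = c + x)" by (auto simp: r_coset_def oag_def)
  also have "\<dots> \<longleftrightarrow> z - x \<in> C" by (metis add_diff_cancel_right' diff_add_cancel)
  finally show ?thesis .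
qed

lemma coset_eq_iff: "\<kappa> x = \<kappa> y \<longleftrightarrow> x - y \<in> C"
proof
  assume "\<kappa> x = \<kappa> y"
  moreover have "x \<in> \<kappa> x" using C by (simp add: mem_coset_iff convex_subgrp_subgrp subgrpD)
  ultimately show "x - y \<in> C" by (simp add: mem_coset_iff)
next
  assume "x - y \<in> C"
  then have "x - z \<in> C \<longleftrightarrow> y - z \<in> C" for z using C subgrp_shift convex_subgrp_subgrp by blast
  then show "\<kappa> x = \<kappa> y"
    using subgrp_diff_commute[OF convex_subgrp_subgrp[OF C]] by (auto simp: mem_coset_iff)
qed

lemma carrier_oquot: "carrier Q = \<kappa> ` B"
  by (auto simp: oquot_def FactGroup_def RCOSETS_def r_coset_def)

lemma one_oquot: "\<one>\<^bsub>Q\<^esub> = \<kappa> 0"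
proof -
  have "\<kappa> 0 = C" by (auto simp: mem_coset_iff)
  then show ?thesis by (simp add: oquot_def FactGroup_def)
qed

lemma mult_oquot: "\<kappa> x \<otimes>\<^bsub>Q\<^esub> \<kappa> y = \<kappa> (x + y)"
proof -
  have "z \<in> \<kappa> x \<otimes>\<^bsub>Q\<^esub> \<kappa> y \<longleftrightarrow> (\<exists>a b. a - x \<in> C \<and> b - y \<in> C \<and> z = a + b)" for z
    by (auto simp: oquot_def FactGroup_def set_mult_def oag_simps mem_coset_iff[symmetric])
  also have "\<dots> z \<longleftrightarrow> z \<in> \<kappa> (x + y)" for z
  proof
    assume "\<exists>a b. a - x \<in> C \<and> b - y \<in> C \<and> z = a + b"
    then obtain a b where "a - x \<in> C" "b - y \<in> C" "z = a + b" by blast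
    moreover have "z - (x + y) = (a - x) + (b - y)" using \<open>z = a + b\<close> by simp
    ultimately show "z \<in> \<kappa> (x + y)"
      using subgrpD(2)[OF convex_subgrp_subgrp[OF C]] by (simp only: mem_coset_iff)
  next
    assume "z \<in> \<kappa> (x + y)"
    then have "(z - y) - x \<in> C \<and> y - y \<in> C \<and> z = (z - y) + y"
      using subgrpD(1)[OF convex_subgrp_subgrp[OF C]] by (simp add: mem_coset_iff algebra_simps)
    then show "\<exists>a b. a - x \<in> C \<and> b - y \<in> C \<and> z = a + b" by blast
  qed
  finally show ?thesis by blast
qed

lemma pow_oquot: "\<kappa> x [^]\<^bsub>Q\<^esub> (n::nat) = \<kappa> (nmul n x)"
proof (induction n)
  case 0 then show ?case using one_oquot by (simp add: nat_pow_def)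
next
  case (Suc n)
  then show ?case using mult_oquot by (simp add: nat_pow_def add.commute)
qed

lemma inv_oquot: "x \<in> B \<Longrightarrow> inv\<^bsub>Q\<^esub> (\<kappa> x) = \<kappa> (- x)"
proof -
  interpret comm_group Q using comm_group_oquot[OF comm_group_convex_subgrp subgroup_convex_subgrp] .
  assume "x \<in> B"
  then show ?thesis
    using B by (intro inv_equality)
     (auto simp: mult_oquot one_oquot carrier_oquot convex_subgrp_subgrp subgrpD)
qed

lemma oleq_oquot: "oleq Q (\<kappa> x) (\<kappa> y) \<longleftrightarrow> (\<exists>c\<in>C. x \<le> y + c)"
proof -
  have "oleq Q (\<kappa> x) (\<kappa> y) \<longleftrightarrow> (\<exists>a b. a - x \<in> C \<and> b - y \<in> C \<and> a \<le> b)"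
    by (auto simp: oquot_def oag_simps mem_coset_iff[symmetric])
  also have "\<dots> \<longleftrightarrow> (\<exists>c\<in>C. x \<le> y + c)"
  proof
    assume "\<exists>a b. a - x \<in> C \<and> b - y \<in> C \<and> a \<le> b"
    then obtain a b where "a - x \<in> C" "b - y \<in> C" "a \<le> b" by blast
    then have "(b - y) - (a - x) \<in> C"
      using subgrpD(4)[OF convex_subgrp_subgrp[OF C]] by blast
    moreover have "x \<le> y + ((b - y) - (a - x))"
      using \<open>a \<le> b\<close> add_left_mono[of a b "x - a"] by (simp add: algebra_simps)
    ultimately show "\<exists>c\<in>C. x \<le> y + c" by blast
  next
    assume "\<exists>c\<in>C. x \<le> y + c"
    then obtain c where "c \<in> C" "x \<le> y + c" by blast
    then have "x - x \<in> C \<and> (y + c) - y \<in> C \<and> x \<le> y + c"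
      using subgrpD(1)[OF convex_subgrp_subgrp[OF C]] by simp
    then show "\<exists>a b. a - x \<in> C \<and> b - y \<in> C \<and> a \<le> b" by blast
  qed
  finally show ?thesis .
qed

text \<open>Regularity of B/C concerns quotients (B/C)/X; here they are tested on representatives in
  B.\<close>

lemma n_divisible_double_quotient:
  assumes "subgroup X Q"
  shows "n_divisible n (oquot Q X) \<longleftrightarrow> (\<forall>x\<in>B. \<exists>y\<in>B. \<kappa> (x - nmul n y) \<in> X)"
proof -
  have "nmul n y \<in> B" if "y \<in> B" for y using B that convex_subgrp_subgrp subgrp_nmul by blast
  then have "\<kappa> x \<otimes>\<^bsub>Q\<^esub> inv\<^bsub>Q\<^esub> (\<kappa> y [^]\<^bsub>Q\<^esub> n) = \<kappa> (x - nmul n y)" if "x \<in> B" "y \<in> B" for x y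
    using that by (simp add: pow_oquot inv_oquot mult_oquot)
  then show ?thesis
    using n_divisible_oquot[OF comm_group_oquot[OF comm_group_convex_subgrp subgroup_convex_subgrp] assms, of n]
    by (simp add: carrier_oquot)
qed

text \<open>Convex subgroups X of B/C correspond to convex D with C \<subseteq> D \<subseteq> B, by
  image one way and preimage the other, and X is nontrivial exactly when D is larger than C. The
  right-hand side no longer mentions records.\<close>

lemma n_regular_oquot_iff:
  "n_regular n Q \<longleftrightarrow>
    (\<forall>D. convex_subgrp D \<and> C \<subset> D \<and> D \<subseteq> B \<longrightarrow> (\<forall>x\<in>B. \<exists>y\<in>B. x - nmul n y \<in> D))"
    (is "?L \<longleftrightarrow> ?R")
proof
  note sB = convex_subgrp_subgrp[OF B] and sC = convex_subgrp_subgrp[OF C]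
  assume L: ?L
  show ?R
  proof (intro allI impI)
    fix D assume "convex_subgrp D \<and> C \<subset> D \<and> D \<subseteq> B"
    then have D: "convex_subgrp D" "C \<subset> D" "D \<subseteq> B" by auto
    note sD = convex_subgrp_subgrp[OF D(1)]
    \<comment> \<open>D contains C, so it is a union of cosets of C and its image loses
      nothing.\<close>
    have memD: "\<kappa> x \<in> \<kappa> ` D \<longleftrightarrow> x \<in> D" for x
    proof
      assume "\<kappa> x \<in> \<kappa> ` D"
      then obtain d where "d \<in> D" "x - d \<in> C" using coset_eq_iff by auto
      then show "x \<in> D" using D(2) subgrpD(2)[OF sD, of "x - d" d] by auto
    qed auto
    have "convex_subgroup (\<kappa> ` D) Q"
      unfolding convex_subgroup_def
    proof (intro conjI ballI impI)
      show "subgroup (\<kappa> ` D) Q"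
      proof
        show "\<kappa> ` D \<subseteq> carrier Q" using D by (auto simp: carrier_oquot)
        show "\<one>\<^bsub>Q\<^esub> \<in> \<kappa> ` D" using sD by (auto simp: one_oquot subgrpD)
        show "x \<otimes>\<^bsub>Q\<^esub> y \<in> \<kappa> ` D" if "x \<in> \<kappa> ` D" "y \<in> \<kappa> ` D" for x y
          using that sD by (auto simp: mult_oquot subgrpD)
        show "inv\<^bsub>Q\<^esub> x \<in> \<kappa> ` D" if "x \<in> \<kappa> ` D" for x
          using that sD D(3) by (auto simp: inv_oquot subgrpD)
      qed
      fix X Z Y assume *: "X \<in> \<kappa> ` D" "Z \<in> \<kappa> ` D" "Y \<in> carrier Q" "oleq Q X Y \<and> oleq Q Y Z"
      then obtain x y z where xyz: "X = \<kappa> x" "Y = \<kappa> y" "Z = \<kappa> z" "x \<in> D" "z \<in> D" "y \<in> B"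
        by (auto simp: carrier_oquot)
      then obtain c d where cd: "c \<in> C" "d \<in> C" "x \<le> y + c" "y \<le> z + d" using * by (auto simp: oleq_oquot)
      have "c \<in> D" "d \<in> D" using cd D(2) by auto
      then have "x - c \<in> D" "z + d \<in> D"
        using xyz subgrpD(4)[OF sD, of x c] subgrpD(2)[OF sD, of z d] by auto
      then have "y \<in> D" using cd convex_subgrp_between[OF D(1), of "x - c" "z + d" y]
        by (simp add: algebra_simps)
      then show "Y \<in> \<kappa> ` D" using xyz by simp
    qed
    moreover have "\<kappa> ` D \<noteq> {\<one>\<^bsub>Q\<^esub>}"
    proof -
      obtain d where "d \<in> D" "d \<notin> C" using D by blast
      then have "\<kappa> d \<noteq> \<kappa> 0" "\<kappa> d \<in> \<kappa> ` D" by (auto simp: coset_eq_iff)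
      then show ?thesis by (auto simp: one_oquot)
    qed
    ultimately have "n_divisible n (oquot Q (\<kappa> ` D))" "subgroup (\<kappa> ` D) Q"
      using L unfolding n_regular_def by (blast, simp only: convex_subgroup_def)
    then show "\<forall>x\<in>B. \<exists>y\<in>B. x - nmul n y \<in> D"
      by (simp add: n_divisible_double_quotient memD)
  qed
next
  note sB = convex_subgrp_subgrp[OF B] and sC = convex_subgrp_subgrp[OF C]
  assume R: ?R
  show ?L
    unfolding n_regular_def
  proof (intro allI impI)
    fix X assume "convex_subgroup X Q \<and> X \<noteq> {\<one>\<^bsub>Q\<^esub>}"
    then have X: "convex_subgroup X Q" "X \<noteq> {\<one>\<^bsub>Q\<^esub>}" by blast+
    from X(1) have sX: "subgroup X Q" unfolding convex_subgroup_def by (rule conjunct1)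
    interpret X: subgroup X Q by (rule sX)
    define D where "D = {x \<in> B. \<kappa> x \<in> X}"
    have "subgrp D"
      unfolding subgrp_def
    proof (intro conjI ballI)
      show "0 \<in> D" using X.one_closed sB by (simp add: D_def one_oquot subgrpD)
      show "x + y \<in> D" if "x \<in> D" "y \<in> D" for x y
        using that X.m_closed[of "\<kappa> x" "\<kappa> y"] sB by (simp add: D_def mult_oquot subgrpD)
      show "- x \<in> D" if "x \<in> D" for x
        using that X.m_inv_closed[of "\<kappa> x"] sB by (simp add: D_def inv_oquot subgrpD)
    qed
    moreover have "y \<in> D" if "x \<in> D" "0 \<le> y" "y \<le> x" for x y
    proof -
      have y: "y \<in> B" using that convex_subgrpD[OF B] by (auto simp: D_def)
      have "\<kappa> 0 \<in> X" "\<kappa> x \<in> X" "\<kappa> y \<in> carrier Q" using X.one_closed that y by (auto simp: D_def one_oquot carrier_oquot)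
      moreover have "oleq Q (\<kappa> 0) (\<kappa> y)" "oleq Q (\<kappa> y) (\<kappa> x)"
        using that subgrpD(1)[OF sC] by (auto simp: oleq_oquot intro!: bexI[of _ 0])
      ultimately have "\<kappa> y \<in> X" using X(1) unfolding convex_subgroup_def by blast
      then show "y \<in> D" using y by (simp add: D_def)
    qed
    ultimately have "convex_subgrp D" by (auto simp: convex_subgrp_def)
    moreover have "C \<subset> D"
    proof
      show "C \<subseteq> D"
      proof
        fix c assume "c \<in> C"
        then have "\<kappa> c = \<kappa> 0" by (simp add: coset_eq_iff)
        then show "c \<in> D" using \<open>c \<in> C\<close> CB X.one_closed by (auto simp: D_def one_oquot)
      qed
      obtain Y where "Y \<in> X" "Y \<noteq> \<kappa> 0" using X(2) X.one_closed unfolding one_oquot by blast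
      then obtain y where "y \<in> B" "Y = \<kappa> y" using X.subset by (auto simp: carrier_oquot)
      then have "y \<in> D" "y \<notin> C" using \<open>Y \<in> X\<close> \<open>Y \<noteq> \<kappa> 0\<close> by (auto simp: D_def coset_eq_iff)
      then show "C \<noteq> D" by blast
    qed
    ultimately have "\<forall>x\<in>B. \<exists>y\<in>B. x - nmul n y \<in> D" using R by (auto simp: D_def)
    then show "n_divisible n (oquot Q X)"
      unfolding n_divisible_double_quotient[OF sX] by (auto simp: D_def)
  qed
qed

end

section \<open>The subgroups B(g) and A_n(g)\<close>

lemma B_sub_oag: "B_sub oag g = conv_hull (g :: 'a::linordered_ab_group_add)"
  unfolding B_sub_def convex_subgroup_oag_iff
  by (rule Least_equality) (auto simp: convex_subgrp_conv_hull conv_hull_self conv_hull_least)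

lemma convex_subgrp_Inter:
  assumes "\<And>C. C \<in> F \<Longrightarrow> convex_subgrp C" shows "convex_subgrp (\<Inter>F)"
  using assms unfolding convex_subgrp_def subgrp_def by blast

text \<open>The condition whose least solution is A_n(g), in terms of subsets of G only.\<close>

definition regular_above :: "nat \<Rightarrow> 'a::linordered_ab_group_add \<Rightarrow> 'a set \<Rightarrow> bool" where
  "regular_above n g C \<longleftrightarrow> convex_subgrp C \<and> C \<subseteq> conv_hull g \<and>
     (\<forall>D. convex_subgrp D \<and> C \<subset> D \<and> D \<subseteq> conv_hull g \<longrightarrow>
        (\<forall>x\<in>conv_hull g. \<exists>y\<in>conv_hull g. x - nmul n y \<in> D))"

text \<open>The intersection of all solutions is again a solution, so the \<open>LEAST\<close> in
  \<open>A_sub\<close> exists.\<close>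

lemma A_sub_least:
  fixes g :: "'a::linordered_ab_group_add"
  shows "regular_above n g (A_sub n oag g)" "regular_above n g C \<Longrightarrow> A_sub n oag g \<subseteq> C"
proof -
  let ?B = "conv_hull g"
  have P_eq: "convex_subgroup C oag \<and> C \<subseteq> B_sub oag g \<and> n_regular n (oquot (oag\<lparr>carrier := B_sub oag g\<rparr>) C)
    \<longleftrightarrow> regular_above n g C" for C
    unfolding convex_subgroup_oag_iff B_sub_oag regular_above_def
    using n_regular_oquot_iff[OF convex_subgrp_conv_hull[of g], of C n] by blast
  have "regular_above n g ?B" by (auto simp: regular_above_def convex_subgrp_conv_hull)
  have "regular_above n g (\<Inter>{C. regular_above n g C})"
  proof -
    have "convex_subgrp (\<Inter>{C. regular_above n g C})" by (rule convex_subgrp_Inter) (simp add: regular_above_def)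
    moreover have "\<Inter>{C. regular_above n g C} \<subseteq> ?B" using \<open>regular_above n g ?B\<close> by blast
    moreover have "\<exists>y\<in>?B. x - nmul n y \<in> D"
      if D: "convex_subgrp D" "\<Inter>{C. regular_above n g C} \<subset> D" "D \<subseteq> ?B" and x: "x \<in> ?B" for D x
    proof -
      \<comment> \<open>Convex subgroups form a chain, so a D strictly above the intersection is
        strictly above one of its members, whose regularity applies to D.\<close>
      obtain C where C: "regular_above n g C" "\<not> D \<subseteq> C" using D(2) by blast
      then have "C \<subset> D" using convex_subgrp_linear[of C D] D(1) by (auto simp: regular_above_def)
      then show ?thesis using C D x by (auto simp: regular_above_def)
    qed
    ultimately show ?thesis unfolding regular_above_def by (intro conjI allI ballI impI) simp_all
  qed
  then have "A_sub n oag g = \<Inter>{C. regular_above n g C}"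
    unfolding A_sub_def P_eq by (intro Least_equality) auto
  then show "regular_above n g (A_sub n oag g)" "regular_above n g C \<Longrightarrow> A_sub n oag g \<subseteq> C"
    using \<open>regular_above n g (\<Inter>{C. regular_above n g C})\<close> by auto
qed

lemma convex_subgrp_A_sub: "convex_subgrp (A_sub n oag (g::'a::linordered_ab_group_add))"
  using A_sub_least(1)[of n g] by (simp add: regular_above_def)

text \<open>Regularity of B(g)/A_n(g) covers C inside B(g); any other C contains g, and b = 0
  works.\<close>

lemma A_sub_regular:
  fixes g :: "'a::linordered_ab_group_add"
  assumes "convex_subgrp C" "A_sub n oag g \<subset> C"
  obtains b where "b \<in> conv_hull g" "g - nmul n b \<in> C"
proof (cases "C \<subseteq> conv_hull g")
  case True
  then show ?thesis using A_sub_least(1)[of n g, unfolded regular_above_def] assms conv_hull_self[of g] that by blast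
next
  case False
  then have "g \<in> C" using convex_subgrp_linear[OF assms(1) convex_subgrp_conv_hull] conv_hull_self by blast
  then show ?thesis using that[of 0] subgrpD(1)[OF convex_subgrp_subgrp[OF convex_subgrp_conv_hull[of g]]] by simp
qed

text \<open>The union V of all convex subgroups missing g is the largest such subgroup. No convex
  subgroup lies strictly between V and B(g), so B(g)/V is regular for trivial reasons and A_n(g)
  \<subseteq> V.\<close>

lemma notin_A_sub:
  fixes g :: "'a::linordered_ab_group_add"
  assumes "g \<noteq> 0" shows "g \<notin> A_sub n oag g"
proof -
  let ?F = "{C. convex_subgrp C \<and> g \<notin> C}"
  define V where "V = \<Union>?F"
  have "subgrp V"
    unfolding subgrp_def
  proof (intro conjI ballI)
    show "0 \<in> V" using assms convex_subgrp_zero unfolding V_def by blast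
    show "- x \<in> V" if "x \<in> V" for x
      using that unfolding V_def using convex_subgrp_subgrp subgrpD(3) by blast
    fix x y assume "x \<in> V" "y \<in> V"
    then obtain C D where "convex_subgrp C" "g \<notin> C" "x \<in> C" "convex_subgrp D" "g \<notin> D" "y \<in> D"
      by (auto simp: V_def)
    moreover from this have "C \<subseteq> D \<or> D \<subseteq> C" using convex_subgrp_linear by blast
    ultimately show "x + y \<in> V" unfolding V_def using convex_subgrp_subgrp subgrpD(2) by blast
  qed
  moreover have "y \<in> V" if "x \<in> V" "0 \<le> y" "y \<le> x" for x y
    using that convex_subgrpD[of _ x y] unfolding V_def by blast
  ultimately have V: "convex_subgrp V" by (auto simp: convex_subgrp_def)
  have "g \<notin> V" by (auto simp: V_def)
  then have "V \<subseteq> conv_hull g"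
    using convex_subgrp_linear[OF V convex_subgrp_conv_hull[of g]] conv_hull_self[of g] by blast
  moreover have "conv_hull g \<subseteq> D" if "convex_subgrp D" "V \<subset> D" for D
    using that conv_hull_least unfolding V_def by blast
  moreover have "0 \<in> conv_hull g"
    using subgrpD(1)[OF convex_subgrp_subgrp[OF convex_subgrp_conv_hull[of g]]] .
  ultimately have "regular_above n g V"
    using V unfolding regular_above_def by (metis diff_zero nmul_0_right subsetD)
  then have "A_sub n oag g \<subseteq> V" by (rule A_sub_least(2))
  then show ?thesis using \<open>g \<notin> V\<close> by blast
qed

lemma RJn_oag: "RJn n oag = {A_sub n oag g | g. g \<noteq> (0::'a::linordered_ab_group_add)}"
  by (simp add: RJn_def oag_def)

lemma convex_subgrp_RJn: "D \<in> RJn n oag \<Longrightarrow> convex_subgrp (D :: 'a::linordered_ab_group_add set)"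
  by (auto simp: RJn_oag convex_subgrp_A_sub)

lemma convex_subgrp_RJ: "D \<in> RJ oag \<Longrightarrow> convex_subgrp (D :: 'a::linordered_ab_group_add set)"
  by (auto simp: RJ_def convex_subgrp_RJn)

lemma finite_chain_least:
  assumes "finite F" "F \<noteq> {}" "\<And>C. C \<in> F \<Longrightarrow> convex_subgrp C"
  obtains C where "C \<in> F" "\<And>D. D \<in> F \<Longrightarrow> C \<subseteq> D"
proof -
  obtain C where "C \<in> F" "\<And>D. D \<in> F \<Longrightarrow> \<not> D \<subset> C"
    using finite_has_minimal[OF assms(1,2)] by blast
  then show thesis using that assms(3) convex_subgrp_linear by (metis psubsetI)
qed

lemma finite_chain_greatest:
  assumes "finite F" "F \<noteq> {}" "\<And>C. C \<in> F \<Longrightarrow> convex_subgrp C"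
  obtains C where "C \<in> F" "\<And>D. D \<in> F \<Longrightarrow> D \<subseteq> C"
proof -
  obtain C where "C \<in> F" "\<And>D. D \<in> F \<Longrightarrow> \<not> C \<subset> D"
    using finite_has_maximal[OF assms(1,2)] by blast
  then show thesis using that assms(3) convex_subgrp_linear by (metis psubsetI)
qed

text \<open>Let C be the least member. A nonzero x in C would give C \<subseteq> A_n(x), although x
  \<notin> A_n(x). The element g only ensures that there is a member at all.\<close>

lemma zero_in_RJn:
  fixes g :: "'a::linordered_ab_group_add"
  assumes "finite (RJn n (oag :: 'a ord_group))" "g \<noteq> 0"
  shows "{0::'a} \<in> RJn n oag"
proof -
  obtain C where C: "C \<in> RJn n oag" "\<And>D. D \<in> RJn n oag \<Longrightarrow> C \<subseteq> (D :: 'a set)"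
  proof (rule finite_chain_least[OF assms(1)])
    show "RJn n (oag :: 'a ord_group) \<noteq> {}" using assms(2) by (auto simp: RJn_oag)
  qed (use convex_subgrp_RJn in auto)
  have "x = 0" if "x \<in> C" for x
  proof (rule ccontr)
    assume "x \<noteq> 0"
    then have "C \<subseteq> A_sub n oag x" "x \<notin> A_sub n oag x" using C(2) notin_A_sub by (auto simp: RJn_oag)
    then show False using that by blast
  qed
  moreover have "0 \<in> C" using C(1) convex_subgrp_RJn convex_subgrp_subgrp subgrpD(1) by blast
  ultimately have "C = {0}" by blast
  then show ?thesis using C by simp
qed

section \<open>Discrete and non-discrete quotients\<close>

lemma least_positive_oquotD:
  fixes c :: "'a::linordered_ab_group_add"
  assumes D: "convex_subgrp D" and "least_positive (oquot oag D) (D #>\<^bsub>oag\<^esub> c)"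
  shows "0 < c" "c \<notin> D" "\<And>y. 0 < y \<Longrightarrow> y \<notin> D \<Longrightarrow> \<exists>d\<in>D. c \<le> y + d"
proof -
  note Q = carrier_oquot[OF convex_subgrp_UNIV D subset_UNIV, unfolded oag_UNIV]
     one_oquot[OF convex_subgrp_UNIV D subset_UNIV, unfolded oag_UNIV]
     oleq_oquot[OF convex_subgrp_UNIV D subset_UNIV, unfolded oag_UNIV]
     coset_eq_iff[OF convex_subgrp_UNIV D subset_UNIV]
  note lp = assms(2)[unfolded least_positive_def Q]
  then show c: "c \<notin> D" by (simp add: Q)
  obtain d where "d \<in> D" "0 \<le> c + d" using lp by auto
  \<comment> \<open>Positivity modulo D lifts to G: a c \<le> 0 would satisfy 0 \<le> -c \<le> d
    with d in D.\<close>
  show "0 < c"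
  proof (rule ccontr)
    assume "\<not> 0 < c"
    then have "0 \<le> - c" "- c \<le> d" using \<open>0 \<le> c + d\<close> add_left_mono[of 0 "c + d" "- c"] by (simp_all add: add.assoc[symmetric])
    then have "- c \<in> D" using convex_subgrpD[OF D \<open>d \<in> D\<close>] by blast
    then show False using c subgrpD(3)[OF convex_subgrp_subgrp[OF D]] by fastforce
  qed
  show "\<exists>d\<in>D. c \<le> y + d" if "0 < y" "y \<notin> D" for y
  proof -
    have "\<exists>d\<in>D. 0 \<le> y + d" using that subgrpD(1)[OF convex_subgrp_subgrp[OF D]] by (auto intro!: bexI[of _ 0])
    then show ?thesis using lp that by (auto simp: Q)
  qed
qed

text \<open>As y is not least positive modulo D, some positive z is smaller modulo D, and both parts
  z and y - z of y stay nonzero there. This is what makes halving possible.\<close>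

lemma not_discrete_oquotD:
  fixes y :: "'a::linordered_ab_group_add"
  assumes D: "convex_subgrp D" and "\<not> discrete_group (oquot oag D)" and y: "0 < y" "y \<notin> D"
  obtains z where "0 < z" "z \<notin> D" "z < y" "y - z \<notin> D"
proof -
  note Q = carrier_oquot[OF convex_subgrp_UNIV D subset_UNIV, unfolded oag_UNIV]
     one_oquot[OF convex_subgrp_UNIV D subset_UNIV, unfolded oag_UNIV]
     oleq_oquot[OF convex_subgrp_UNIV D subset_UNIV, unfolded oag_UNIV]
     coset_eq_iff[OF convex_subgrp_UNIV D subset_UNIV]
  note s = convex_subgrp_subgrp[OF D]
  have "\<not> least_positive (oquot oag D) (D #>\<^bsub>oag\<^esub> y)" using assms by (auto simp: discrete_group_def)
  moreover have "\<exists>d\<in>D. 0 \<le> y + d" using y subgrpD(1)[OF s] by (auto intro!: bexI[of _ 0])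
  ultimately obtain z where z: "z \<notin> D" "\<exists>d\<in>D. 0 \<le> z + d" "\<not> (\<exists>d\<in>D. y \<le> z + d)"
    unfolding least_positive_def Q using y by (auto simp: Q)
  have "z < y" using z(3) subgrpD(1)[OF s] by (metis add.right_neutral linorder_not_less)
  moreover have "y - z \<notin> D" using z(3) by (metis add.commute diff_add_cancel order_refl)
  moreover have "0 < z"
  proof (rule ccontr)
    assume "\<not> 0 < z"
    obtain d where "d \<in> D" "0 \<le> z + d" using z by blast
    then have "0 \<le> - z" "- z \<le> d" using \<open>\<not> 0 < z\<close> \<open>0 \<le> z + d\<close> add_left_mono[of 0 "z + d" "- z"]
      by (simp_all add: add.assoc[symmetric])
    then have "- z \<in> D" using convex_subgrpD[OF D \<open>d \<in> D\<close>] by blast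
    then show False using z subgrpD(3)[OF s] by fastforce
  qed
  ultimately show thesis using that z by blast
qed

section \<open>Solving congruences\<close>

definition divisible_mod :: "nat \<Rightarrow> 'a::ab_group_add set \<Rightarrow> 'a set \<Rightarrow> bool" where
  "divisible_mod n E C \<longleftrightarrow> (\<forall>x\<in>E. \<exists>y\<in>E. x - nmul n y \<in> C)"

lemma divisible_mod_mult:
  assumes "divisible_mod a E C" "divisible_mod b E C" "subgrp C"
  shows "divisible_mod (a * b) E C"
  unfolding divisible_mod_def
proof
  fix x assume "x \<in> E"
  then obtain y where y: "y \<in> E" "x - nmul a y \<in> C" using assms by (auto simp: divisible_mod_def)
  then obtain z where z: "z \<in> E" "y - nmul b z \<in> C" using assms by (auto simp: divisible_mod_def)
  have "x - nmul (a * b) z = (x - nmul a y) + nmul a (y - nmul b z)"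
    by (simp add: nmul_diff nmul_mult)
  moreover have "\<dots> \<in> C"
    using subgrpD(2)[OF assms(3) y(2) subgrp_nmul[OF assms(3) z(2)]] .
  ultimately have "x - nmul (a * b) z \<in> C" by (simp only:)
  then show "\<exists>y\<in>E. x - nmul (a * b) y \<in> C" using z(1) by (rule bexI)
qed

lemma divisible_mod_1: "subgrp C \<Longrightarrow> divisible_mod (Suc 0) E C"
  by (auto simp: divisible_mod_def subgrpD intro!: bexI)

lemma divisible_mod_power: "divisible_mod p E C \<Longrightarrow> subgrp C \<Longrightarrow> divisible_mod (p ^ m) E C"
  by (induction m) (auto intro: divisible_mod_mult divisible_mod_1)

lemma divisible_mod_prod:
  "finite P \<Longrightarrow> subgrp C \<Longrightarrow> (\<And>p. p \<in> P \<Longrightarrow> divisible_mod (f p) E C) \<Longrightarrow> divisible_mod (\<Prod>p\<in>P. f p) E C"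
  by (induction P rule: finite_induct) (auto intro: divisible_mod_mult divisible_mod_1)

text \<open>Each x in E outside C is divisible by n modulo C inside B(x) \<subseteq> E, because
  B(x)/A_n(x) is regular and C is strictly above A_n(x). This turns the position of the members of
  RJ_n into divisibility.\<close>

lemma divisible_mod_A_sub:
  fixes C E :: "'a::linordered_ab_group_add set"
  assumes "convex_subgrp C" "convex_subgrp E"
    and "\<And>g. g \<in> E \<Longrightarrow> g \<notin> C \<Longrightarrow> A_sub n oag g \<subset> C"
  shows "divisible_mod n E C"
  unfolding divisible_mod_def
proof
  fix x assume x: "x \<in> E"
  show "\<exists>y\<in>E. x - nmul n y \<in> C"
  proof (cases "x \<in> C")
    case True
    then show ?thesis using subgrpD(1)[OF convex_subgrp_subgrp[OF assms(2)]] by (auto intro!: bexI[of _ 0])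
  next
    case False
    then obtain b where "b \<in> conv_hull x" "x - nmul n b \<in> C"
      using A_sub_regular[OF assms(1) assms(3)[OF x]] by blast
    then show ?thesis using conv_hull_least[OF assms(2) x] by blast
  qed
qed

section \<open>Intervals and residue classes\<close>

lemma archimedean_quotient:
  fixes w :: "'a::linordered_ab_group_add"
  assumes "0 \<le> w" "w \<le> nmul k e" "0 < e"
  obtains q where "nmul q e \<le> w" "w < nmul (Suc q) e"
proof -
  define q where "q = (LEAST q. w < nmul (Suc q) e)"
  have "w < nmul (Suc k) e" using assms by (simp add: add_strict_increasing)
  then have q: "w < nmul (Suc q) e" unfolding q_def by (rule LeastI)
  have "nmul q e \<le> w"
  proof (cases q)
    case (Suc r)
    then have "\<not> w < nmul (Suc r) e" using not_less_Least[of r "\<lambda>q. w < nmul (Suc q) e"] by (simp add: q_def)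
    then show ?thesis using Suc by simp
  qed (use assms in simp)
  then show thesis using q that by blast
qed

text \<open>Since \<open>E = conv_hull e + n E\<close>, a representative of the class is within a multiple of \<open>e\<close> of \<open>a\<close>
  and can be shifted by multiples of \<open>n e \<in> n E\<close>.\<close>

lemma interval_meets_class:
  fixes e :: "'a::linordered_ab_group_add"
  assumes E: "subgrp E" and e: "e \<in> E" "0 < e" and n: "0 < n"
    and div: "divisible_mod n E (conv_hull e)" and h: "h - a \<in> E"
  obtains y z where "a \<le> y" "y < a + nmul n e" "z \<in> E" "y - h = nmul n z"
proof -
  obtain v where v: "v \<in> E" "h - a - nmul n v \<in> conv_hull e"
    using div h by (auto simp: divisible_mod_def)
  define w where "w = h - a - nmul n v"
  have "max e (- e) = e" using e(2) by (intro max_absorb1) (simp add: less_imp_le)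
  then obtain k where k: "max w (- w) \<le> nmul k e"
    using v(2) unfolding conv_hull_def w_def mem_Collect_eq by metis
  \<comment> \<open>The absolute value of w is at most k e \<le> k n e, so adding k n e, an element
    of nE, makes w nonnegative.\<close>
  have "nmul k e \<le> nmul k (nmul n e)" by (intro nmul_mono nmul_ge_self less_imp_le[OF e(2)] n)
  then have "- w \<le> nmul k (nmul n e)" "w \<le> nmul k (nmul n e)" using k by auto
  then have "0 \<le> w + nmul k (nmul n e)" "w + nmul k (nmul n e) \<le> nmul (k + k) (nmul n e)"
    using add_left_mono[of "- w" "nmul k (nmul n e)" w]
    by (auto simp: nmul_add_left)
  moreover have "0 < nmul n e" using nmul_strict_mono[OF n e(2)] by simp
  ultimately obtain q where q: "nmul q (nmul n e) \<le> w + nmul k (nmul n e)"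
      "w + nmul k (nmul n e) < nmul (Suc q) (nmul n e)"
    by (rule archimedean_quotient)
  \<comment> \<open>y is a plus the remainder of the division by n e, hence less than n e above
    a.\<close>
  define y where "y = a + (w + nmul k (nmul n e) - nmul q (nmul n e))"
  have "a \<le> y" using q(1) by (simp add: y_def)
  moreover have "y < a + nmul n e" using q(2) by (simp add: y_def algebra_simps)
  moreover have "nmul k e - nmul q e - v \<in> E" using subgrpD(4)[OF E] subgrp_nmul[OF E e(1)] v(1) by simp
  moreover have "y - h = nmul n (nmul k e - nmul q e - v)"
    by (simp add: y_def w_def nmul_diff nmul_add nmul_commute[of n k e] nmul_commute[of n q e] algebra_simps)
  ultimately show thesis using that by blast
qed

section \<open>Congruences for a single prime\<close>

lemma card_image_kernel_cong:
  assumes "\<And>s t. s \<in> T \<Longrightarrow> t \<in> T \<Longrightarrow> f s = f t \<longleftrightarrow> g s = g t"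
  shows "card (f ` T) = card (g ` T)"
proof -
  \<comment> \<open>Sending f t to g t is well defined and injective because f and g identify the
    same indices.\<close>
  have "bij_betw (\<lambda>z. g (inv_into T f z)) (f ` T) (g ` T)"
  proof (rule bij_betw_imageI)
    show "inj_on (\<lambda>z. g (inv_into T f z)) (f ` T)"
      by (rule inj_onI) (metis assms f_inv_into_f inv_into_into)
    have "g (inv_into T f (f t)) = g t" if "t \<in> T" for t
      using that by (metis assms f_inv_into_f imageI inv_into_into)
    then show "(\<lambda>z. g (inv_into T f z)) ` f ` T = g ` T" by (force simp: image_image)
  qed
  then show ?thesis by (rule bij_betw_same_card)
qed

text \<open>The \<open>w t\<close> and the \<open>w' t\<close> fall into the same number of classes modulo \<open>Q\<close>. The former miss the
  class of \<open>0\<close>, so the latter cannot cover all classes met by \<open>X\<close>.\<close>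

lemma avoid_classes:
  fixes w w' :: "'i \<Rightarrow> 'a::ab_group_add"
  assumes Q: "subgrp Q" and T: "finite T" and X: "0 \<in> X" "\<And>t. t \<in> T \<Longrightarrow> w t \<in> X"
    and nz: "\<And>t. t \<in> T \<Longrightarrow> w t \<notin> Q"
    and eq: "\<And>s t. s \<in> T \<Longrightarrow> t \<in> T \<Longrightarrow> w s - w t \<in> Q \<longleftrightarrow> w' s - w' t \<in> Q"
  obtains v where "v \<in> X" "\<And>t. t \<in> T \<Longrightarrow> v - w' t \<notin> Q"
proof (rule ccontr)
  note found = that
  assume "\<not> thesis"
  then have cover: "\<exists>t\<in>T. v - w' t \<in> Q" if "v \<in> X" for v using that found by blast
  define c where "c y = {z. z - y \<in> Q}" for y
  have c: "c y = c z \<longleftrightarrow> y - z \<in> Q" for y z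
  proof
    assume "c y = c z"
    moreover have "y \<in> c y" using subgrpD(1)[OF Q] by (simp add: c_def)
    ultimately show "y - z \<in> Q" by (simp add: c_def)
  next
    assume "y - z \<in> Q"
    then show "c y = c z" using subgrp_shift[OF Q] subgrp_diff_commute[OF Q] unfolding c_def by blast
  qed
  have sub: "c ` X \<subseteq> (c \<circ> w') ` T"
  proof
    fix z assume "z \<in> c ` X"
    then obtain v where "v \<in> X" "z = c v" by blast
    moreover from this obtain t where "t \<in> T" "v - w' t \<in> Q" using cover by blast
    ultimately show "z \<in> (c \<circ> w') ` T" by (auto simp: c)
  qed
  have "card ((c \<circ> w) ` T) = card ((c \<circ> w') ` T)"
    by (rule card_image_kernel_cong) (simp add: c eq)
  moreover have "(c \<circ> w) ` T \<subset> c ` X"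
  proof
    show "(c \<circ> w) ` T \<subseteq> c ` X" using X by auto
    have "c 0 \<notin> (c \<circ> w) ` T"
    proof
      assume "c 0 \<in> (c \<circ> w) ` T"
      then obtain t where "t \<in> T" "c (w t) = c 0" by auto
      then show False using nz by (simp add: c)
    qed
    then show "(c \<circ> w) ` T \<noteq> c ` X" using X by blast
  qed
  \<comment> \<open>X may be infinite; the cover makes its set of classes finite, so that the
    cardinalities can be compared.\<close>
  ultimately show False
    using sub T by (metis card_mono card_seteq finite_imageI finite_subset leD psubset_card_mono)
qed

text \<open>With \<open>x - u r \<in> D + p\<^sup>\<mu> G\<close> for \<open>\<mu>\<close> as large as possible, \<open>y\<close> is sought in
  \<open>(h + E) \<inter> (u' r + D + p\<^sup>\<mu> G)\<close>. This settles the congruences modulo \<open>p\<^sup>m\<close> for \<open>m \<le> \<mu>\<close>; those for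
  \<open>m > \<mu>\<close> all have to fail, which is arranged by avoiding finitely many classes of \<open>p\<^sup>\<mu> E\<close>.\<close>

lemma match_congruences_step:
  fixes u u' :: "'i \<Rightarrow> 'a::linordered_ab_group_add"
  assumes D: "convex_subgrp D" and E: "convex_subgrp E" and DE: "D \<subseteq> E" and p: "0 < p" and T: "finite T"
    and agree: "\<And>s t m. s \<in> T \<Longrightarrow> t \<in> T \<Longrightarrow> m \<le> M \<Longrightarrow>
      u s - u t \<in> cong_grp D (p ^ m) \<longleftrightarrow> u' s - u' t \<in> cong_grp D (p ^ m)"
    and hE: "\<And>t m. t \<in> T \<Longrightarrow> m \<le> M \<Longrightarrow>
      x - u t \<in> cong_grp E (p ^ m) \<longleftrightarrow> h - u' t \<in> cong_grp E (p ^ m)"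
  obtains y where "y - h \<in> E"
    "\<And>t m. t \<in> T \<Longrightarrow> m \<le> M \<Longrightarrow> x - u t \<in> cong_grp D (p ^ m) \<longleftrightarrow> y - u' t \<in> cong_grp D (p ^ m)"
proof (cases "T = {}")
  case True
  then show ?thesis using that[of h] subgrpD(1)[OF convex_subgrp_subgrp[OF E]] by simp
next
  case False
  define Q where "Q m = cong_grp D (p ^ m)" for m
  define EQ where "EQ m = cong_grp E (p ^ m)" for m
  have sD: "subgrp D" and sE: "subgrp E" using D E convex_subgrp_subgrp by auto
  have sQ: "subgrp (Q m)" and sEQ: "subgrp (EQ m)" for m
    using sD sE subgrp_cong_grp by (auto simp: Q_def EQ_def)
  have Q_EQ: "Q m \<subseteq> EQ m" for m using cong_grp_mono[OF DE] by (simp add: Q_def EQ_def)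
  have Q_anti: "Q m \<subseteq> Q k" if "k \<le> m" for k m
    unfolding Q_def by (rule cong_grp_antimono) (rule le_imp_power_dvd[OF that])
  have mulQ: "nmul (p ^ m) z \<in> Q m" for m z using cong_grp_mult[OF sD] by (simp add: Q_def)
  \<comment> \<open>Level 0 always belongs to W, since congruences modulo \<open>p ^ 0\<close> are
    trivial; the cap M keeps W finite.\<close>
  define W where "W = {m. m \<le> M \<and> (\<exists>t\<in>T. x - u t \<in> Q m)}"
  have "finite W" by (auto simp: W_def)
  moreover have "0 \<in> W" using False sD by (auto simp: W_def Q_def)
  ultimately have "Max W \<in> W" and W_max: "\<And>m. m \<in> W \<Longrightarrow> m \<le> Max W"
    by (auto intro: Max_in)
  define \<mu> where "\<mu> = Max W"
  obtain r where r: "r \<in> T" "x - u r \<in> Q \<mu>" and \<mu>: "\<mu> \<le> M"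
    using \<open>Max W \<in> W\<close> by (auto simp: W_def \<mu>_def)
  have above: "x - u t \<notin> Q m" if "t \<in> T" "m \<le> M" "\<mu> < m" for t m
    using W_max[of m, folded \<mu>_def] that by (auto simp: W_def)
  have "h - u' r \<in> EQ \<mu>" using hE[OF r(1) \<mu>] r(2) Q_EQ by (auto simp: EQ_def)
  then obtain e a where ea: "e \<in> E" "h - u' r = e + nmul (p ^ \<mu>) a"
    unfolding EQ_def by (rule cong_grpE)
  \<comment> \<open>y0 lies in h + E and in u' r + p^\<mu> G. Adding an element of X = p^\<mu> E
    preserves both.\<close>
  define y0 where "y0 = h - e"
  define X where "X = {nmul (p ^ \<mu>) e | e. e \<in> E}"
  \<comment> \<open>Only these t can cause harm at a level \<mu> + 1 \<le> M. If x - u t is outside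
    E + p^(\<mu>+1) G, then by \<open>hE\<close> no element of h + E is congruent to u' t; if it
    fails at level \<mu>, the failure is already transferred.\<close>
  define T0 where "T0 = {t \<in> T. x - u t \<in> EQ (Suc \<mu>) \<and> x - u t \<in> Q \<mu>}"
  have finite_T0: "finite T0" using T by (simp add: T0_def)
  \<comment> \<open>x - u t has a decomposition in E + p^(\<mu>+1) G and one in D + p^\<mu> G.
    Comparing them puts p^\<mu> f into E, and purity puts f into E; so the class of u t - x modulo
    \<open>Q (Suc \<mu>)\<close> has a representative in p^\<mu> E.\<close>
  have "\<exists>w\<in>X. (u t - x) - w \<in> Q (Suc \<mu>)" if "t \<in> T0" for t
  proof -
    have "x - u t \<in> cong_grp E (p ^ Suc \<mu>)" "x - u t \<in> cong_grp D (p ^ \<mu>)"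
      using that unfolding T0_def EQ_def Q_def by blast+
    then obtain e1 g1 d2 g2 where 1: "e1 \<in> E" "x - u t = e1 + nmul (p ^ Suc \<mu>) g1"
      and 2: "d2 \<in> D" "x - u t = d2 + nmul (p ^ \<mu>) g2"
      by (meson cong_grpE)
    define f where "f = g2 - nmul p g1"
    have pf: "nmul (p ^ \<mu>) f = nmul (p ^ \<mu>) g2 - nmul (p ^ Suc \<mu>) g1"
      by (simp only: f_def nmul_diff power_Suc2 nmul_mult)
    also have "\<dots> = e1 - d2" using 1(2) 2(2) by (simp add: algebra_simps)
    finally have "nmul (p ^ \<mu>) f \<in> E" using 1(1) 2(1) DE subgrpD(4)[OF sE] by auto
    then have "f \<in> E" using convex_subgrp_pure[OF E] p by (metis zero_less_power)
    then have "nmul (p ^ \<mu>) (- f) \<in> X" using subgrpD(3)[OF sE] by (auto simp: X_def)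
    moreover have "(u t - x) - nmul (p ^ \<mu>) (- f) = - (d2 + nmul (p ^ Suc \<mu>) g1)"
      using 2(2) pf by (simp add: nmul_minus algebra_simps)
    moreover have "\<dots> \<in> Q (Suc \<mu>)"
      using subgrpD(3)[OF sQ] cong_grpI[OF 2(1) refl] unfolding Q_def by blast
    ultimately have "(u t - x) - nmul (p ^ \<mu>) (- f) \<in> Q (Suc \<mu>)" by (simp only:)
    then show ?thesis using \<open>nmul (p ^ \<mu>) (- f) \<in> X\<close> by (rule bexI)
  qed
  then obtain w where w: "\<And>t. t \<in> T0 \<Longrightarrow> w t \<in> X" "\<And>t. t \<in> T0 \<Longrightarrow> (u t - x) - w t \<in> Q (Suc \<mu>)"
    by metis
  define w' where "w' t = u' t - y0" for t
  \<comment> \<open>For \<mu> = M there is no higher level to avoid, and v = 0 will do.\<close>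
  have "\<exists>v\<in>X. \<mu> < M \<longrightarrow> (\<forall>t\<in>T0. v - w' t \<notin> Q (Suc \<mu>))"
  proof (cases "\<mu> < M")
    case True
    have "0 \<in> X" using subgrpD(1)[OF sE] by (auto simp: X_def intro: exI[of _ 0])
    moreover have "w t \<notin> Q (Suc \<mu>)" if "t \<in> T0" for t
    proof
      assume "w t \<in> Q (Suc \<mu>)"
      then have "u t - x \<in> Q (Suc \<mu>)" using subgrpD(2)[OF sQ w(2)[OF that]] by fastforce
      then show False using above[of t "Suc \<mu>"] that True subgrp_diff_commute[OF sQ] by (auto simp: T0_def)
    qed
    \<comment> \<open>Differences of the w are those of the u up to \<open>Q (Suc \<mu>)\<close>,
      and differences of the w' are exactly those of the u', so \<open>agree\<close>
      transfers.\<close>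
    moreover have "w s - w t \<in> Q (Suc \<mu>) \<longleftrightarrow> w' s - w' t \<in> Q (Suc \<mu>)" if st: "s \<in> T0" "t \<in> T0" for s t
    proof -
      have "((u s - x) - w s) - ((u t - x) - w t) \<in> Q (Suc \<mu>)" using st w(2) subgrpD(4)[OF sQ] by blast
      then have "(u s - u t) - (w s - w t) \<in> Q (Suc \<mu>)" by (simp add: algebra_simps)
      then have "u s - u t \<in> Q (Suc \<mu>) \<longleftrightarrow> w s - w t \<in> Q (Suc \<mu>)"
        using subgrp_shift[OF sQ, of _ _ _ 0] by simp
      moreover have "w' s - w' t = u' s - u' t" by (simp add: w'_def)
      ultimately show ?thesis using agree[of s t "Suc \<mu>"] st True by (auto simp: T0_def Q_def)
    qed
    ultimately obtain v where "v \<in> X" "\<And>t. t \<in> T0 \<Longrightarrow> v - w' t \<notin> Q (Suc \<mu>)"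
      using avoid_classes[where Q = "Q (Suc \<mu>)" and T = T0 and X = X and w = w and w' = w'] sQ w(1) T
      by (metis finite_T0)
    then show ?thesis by blast
  next
    case False
    then show ?thesis using subgrpD(1)[OF sE] by (auto simp: X_def intro!: exI[of _ 0])
  qed
  then obtain v where v: "v \<in> X" "\<And>t. \<mu> < M \<Longrightarrow> t \<in> T0 \<Longrightarrow> v - w' t \<notin> Q (Suc \<mu>)" by blast
  obtain f where f: "f \<in> E" "v = nmul (p ^ \<mu>) f" using v(1) by (auto simp: X_def)
  define y where "y = y0 + v"
  have yh: "y - h \<in> E"
    using subgrpD(4)[OF sE subgrp_nmul[OF sE f(1)] ea(1)] by (simp add: y_def y0_def f(2))
  have "y - u' r = nmul (p ^ \<mu>) (a + f)"
    using ea(2) by (simp add: y_def y0_def f(2) nmul_add algebra_simps)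
  then have yr: "y - u' r \<in> Q \<mu>" using mulQ by simp
  have low: "x - u t \<in> Q m \<longleftrightarrow> y - u' t \<in> Q m" if "t \<in> T" "m \<le> \<mu>" for t m
  proof -
    have "x - u t \<in> Q m \<longleftrightarrow> u r - u t \<in> Q m"
      using subgrp_shift[OF sQ] Q_anti[OF that(2)] r(2) by blast
    also have "\<dots> \<longleftrightarrow> u' r - u' t \<in> Q m" using agree[OF r(1) that(1)] that(2) \<mu> by (simp add: Q_def)
    also have "\<dots> \<longleftrightarrow> y - u' t \<in> Q m"
      using subgrp_shift[OF sQ] Q_anti[OF that(2)] yr by blast
    finally show ?thesis .
  qed
  have "x - u t \<in> Q m \<longleftrightarrow> y - u' t \<in> Q m" if t: "t \<in> T" and m: "m \<le> M" for t m
  proof (cases "m \<le> \<mu>")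
    case True
    then show ?thesis using low t by blast
  next
    case False
    \<comment> \<open>A congruence at a higher level implies the one at level \<mu> + 1, so it is
      enough to fail there.\<close>
    have "y - u' t \<notin> Q (Suc \<mu>)"
    proof
      assume y: "y - u' t \<in> Q (Suc \<mu>)"
      then have "y - u' t \<in> EQ (Suc \<mu>)" using Q_EQ by blast
      moreover have "y - h \<in> EQ (Suc \<mu>)" using yh cong_grp_base by (simp add: EQ_def)
      ultimately have "h - u' t \<in> EQ (Suc \<mu>)" using subgrp_shift[OF sEQ] by blast
      then have "x - u t \<in> EQ (Suc \<mu>)" using hE[of t "Suc \<mu>"] t False m by (simp add: EQ_def)
      moreover have "x - u t \<in> Q \<mu>" using low[of t \<mu>] t y Q_anti[of \<mu> "Suc \<mu>"] by auto
      ultimately have "t \<in> T0" using t by (simp add: T0_def)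
      moreover have "v - w' t = y - u' t" by (simp add: w'_def y_def)
      moreover have "\<mu> < M" using False m by simp
      ultimately show False using v(2)[of t] y by (simp only:)
    qed
    then have "y - u' t \<notin> Q m" using Q_anti[of "Suc \<mu>" m] False by auto
    then show ?thesis using above[OF t m] False by simp
  qed
  then show ?thesis using that[OF yh] by (simp add: Q_def)
qed

text \<open>Once the largest D is settled within h + E, D takes the place of E. All later
  corrections lie in D and thus keep every congruence modulo D + p^m G.\<close>

lemma match_congruences_chain:
  fixes u u' :: "'i \<Rightarrow> 'a::linordered_ab_group_add"
  assumes "finite F" "\<And>D. D \<in> F \<Longrightarrow> convex_subgrp D \<and> D \<subseteq> E" "convex_subgrp E" "0 < p" "finite T"
    and "\<And>s t m D. s \<in> T \<Longrightarrow> t \<in> T \<Longrightarrow> m \<le> M \<Longrightarrow> D \<in> F \<Longrightarrow>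
      u s - u t \<in> cong_grp D (p ^ m) \<longleftrightarrow> u' s - u' t \<in> cong_grp D (p ^ m)"
    and "\<And>t m. t \<in> T \<Longrightarrow> m \<le> M \<Longrightarrow>
      x - u t \<in> cong_grp E (p ^ m) \<longleftrightarrow> h - u' t \<in> cong_grp E (p ^ m)"
  shows "\<exists>y. y - h \<in> E \<and> (\<forall>t\<in>T. \<forall>D\<in>F. \<forall>m\<le>M.
    x - u t \<in> cong_grp D (p ^ m) \<longleftrightarrow> y - u' t \<in> cong_grp D (p ^ m))"
  using assms
proof (induction "card F" arbitrary: F E h rule: less_induct)
  case less
  show ?case
  proof (cases "F = {}")
    case True
    then show ?thesis using subgrpD(1)[OF convex_subgrp_subgrp[OF less.prems(3)]] by (intro exI[of _ h]) auto
  next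
    case False
    then obtain D where D: "D \<in> F" "\<And>C. C \<in> F \<Longrightarrow> C \<subseteq> D"
      using finite_chain_greatest[OF less.prems(1)] less.prems(2) by metis
    have cD: "convex_subgrp D" "D \<subseteq> E" using less.prems(2) D by auto
    obtain y1 where y1: "y1 - h \<in> E" "\<And>t m. t \<in> T \<Longrightarrow> m \<le> M \<Longrightarrow>
        x - u t \<in> cong_grp D (p ^ m) \<longleftrightarrow> y1 - u' t \<in> cong_grp D (p ^ m)"
      by (rule match_congruences_step[where x = x and h = h and u = u and u' = u' and T = T and M = M and p = p,
            OF cD(1) less.prems(3) cD(2) less.prems(4,5)]) (use less.prems(6,7) D(1) in auto)
    have "\<exists>y. y - y1 \<in> D \<and> (\<forall>t\<in>T. \<forall>C\<in>F - {D}. \<forall>m\<le>M.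
        x - u t \<in> cong_grp C (p ^ m) \<longleftrightarrow> y - u' t \<in> cong_grp C (p ^ m))"
    proof (rule less.hyps)
      show "card (F - {D}) < card F" using D(1) less.prems(1) by (meson card_Diff1_less)
    qed (use less.prems D cD y1 in auto)
    then obtain y where y: "y - y1 \<in> D" "\<And>t C m. t \<in> T \<Longrightarrow> C \<in> F - {D} \<Longrightarrow> m \<le> M \<Longrightarrow>
        x - u t \<in> cong_grp C (p ^ m) \<longleftrightarrow> y - u' t \<in> cong_grp C (p ^ m)" by blast
    have "(y - y1) + (y1 - h) \<in> E"
      using subgrpD(2)[OF convex_subgrp_subgrp[OF less.prems(3)] _ y1(1)] y(1) cD(2) by blast
    then have "y - h \<in> E" by simp
    moreover have "x - u t \<in> cong_grp D (p ^ m) \<longleftrightarrow> y - u' t \<in> cong_grp D (p ^ m)"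
      if "t \<in> T" "m \<le> M" for t m
      using y1(2)[OF that] subgrp_shift[OF subgrp_cong_grp[OF convex_subgrp_subgrp[OF cD(1)]] cong_grp_base[OF y(1)]]
      by blast
    ultimately show ?thesis using y(2) by (intro exI[of _ y]) blast
  qed
qed

text \<open>One prime q is added at a time. The correction n y is divisible by p^M for all earlier
  p, and Bezout is applied inside E, so that h never leaves b + E.\<close>

lemma crt_family:
  fixes b :: "'a::linordered_ab_group_add"
  assumes "finite P" "\<And>p. p \<in> P \<Longrightarrow> prime p" "subgrp E" "\<And>p. p \<in> P \<Longrightarrow> hp p - b \<in> E"
  shows "\<exists>h. h - b \<in> E \<and> (\<forall>p\<in>P. \<exists>z\<in>E. h - hp p = nmul (p ^ M) z)"
  using assms
proof (induction P rule: finite_induct)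
  case empty
  then show ?case using subgrpD(1)[OF empty.prems(2)] by (intro exI[of _ b]) simp
next
  case (insert q P)
  note s = insert.prems(2)
  obtain h where h: "h - b \<in> E" "\<forall>p\<in>P. \<exists>z\<in>E. h - hp p = nmul (p ^ M) z"
    using insert.IH insert.prems by auto
  define n where "n = (\<Prod>p\<in>P. p ^ M)"
  have "coprime (q ^ M) (p ^ M)" if "p \<in> P" for p
    using that insert.prems(1) insert.hyps(2) by (auto intro!: primes_coprime)
  then have cop: "coprime n (q ^ M)"
    unfolding n_def by (intro prod_coprime_left) (simp only: coprime_commute)
  have "hp q - h \<in> E" using subgrpD(4)[OF s insert.prems(3)[of q] h(1)] by simp
  then obtain y z where yz: "y \<in> E" "z \<in> E" "hp q - h = nmul n y + nmul (q ^ M) z"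
    using coprime_decomp[OF cop s] by blast
  have "(h - b) + nmul n y \<in> E" using subgrpD(2)[OF s h(1) subgrp_nmul[OF s yz(1)]] .
  then have "(h + nmul n y) - b \<in> E" by (simp add: algebra_simps)
  moreover have "\<exists>z\<in>E. (h + nmul n y) - hp p = nmul (p ^ M) z" if p: "p \<in> insert q P" for p
  proof (cases "p = q")
    case True
    have "(h + nmul n y) - hp q = nmul (q ^ M) (- z)"
      using yz(3) by (simp add: nmul_minus algebra_simps)
    then show ?thesis using True subgrpD(3)[OF s yz(2)] by blast
  next
    case False
    then have "p \<in> P" using p by simp
    then obtain z' where z': "z' \<in> E" "h - hp p = nmul (p ^ M) z'" using h(2) by blast
    have "p ^ M dvd n" unfolding n_def using \<open>p \<in> P\<close> insert.hyps(1) by (rule dvd_prodI[rotated])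
    then obtain k where "n = p ^ M * k" by (rule dvdE)
    then have "nmul n y = nmul (p ^ M) (nmul k y)" by (simp only: nmul_mult)
    then have "(h + nmul n y) - hp p = nmul (p ^ M) (z' + nmul k y)"
      using z'(2) by (simp add: nmul_add algebra_simps)
    then show ?thesis using subgrpD(2)[OF s z'(1) subgrp_nmul[OF s yz(1)]] by blast
  qed
  ultimately show ?case by blast
qed

text \<open>\<open>D\<close> is the least member of \<open>RJn p oag\<close> above \<open>E\<close>; the first alternative holds if there is none.\<close>

lemma cong_grp_next:
  fixes E :: "'a::linordered_ab_group_add set"
  assumes "finite (RJn p (oag :: 'a ord_group))" "convex_subgrp E"
  shows "(\<forall>m. cong_grp E (p ^ m) = UNIV) \<or>
    (\<exists>D\<in>RJn p oag. E \<subseteq> D \<and> (\<forall>m. cong_grp E (p ^ m) = cong_grp D (p ^ m)))"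
proof (cases "E \<in> RJn p oag")
  case False
  \<comment> \<open>\<open>UNIV\<close> guarantees a least member; it stands for the case that
    \<open>RJn p oag\<close> has no member above E, where E + p^m G is everything.\<close>
  define F where "F = {D \<in> insert UNIV (RJn p oag). E \<subseteq> D}"
  have "finite F" "F \<noteq> {}" and cF: "\<And>D. D \<in> F \<Longrightarrow> convex_subgrp D"
    using assms(1) convex_subgrp_RJn by (auto simp: F_def)
  then obtain D where D: "D \<in> F" "\<And>C. C \<in> F \<Longrightarrow> D \<subseteq> C"
    by (rule finite_chain_least) (assumption, rule that)
  have cD: "convex_subgrp D" "E \<subseteq> D" using D(1) convex_subgrp_RJn by (auto simp: F_def)
  note sE = convex_subgrp_subgrp[OF assms(2)]
  have div: "divisible_mod p D E"
  proof (rule divisible_mod_A_sub[OF assms(2) cD(1)])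
    fix g assume g: "g \<in> D" "g \<notin> E"
    then have "g \<noteq> 0" using subgrpD(1)[OF sE] by auto
    then have A: "A_sub p oag g \<in> RJn p oag" "g \<notin> A_sub p oag g"
      using notin_A_sub by (auto simp: RJn_oag)
    \<comment> \<open>Otherwise A_p(g) would belong to F, so D \<subseteq> A_p(g), although g is in
      D and not in A_p(g).\<close>
    then have "\<not> E \<subseteq> A_sub p oag g" using D(2)[of "A_sub p oag g"] g by (auto simp: F_def)
    then show "A_sub p oag g \<subset> E"
      using convex_subgrp_linear[OF assms(2) convex_subgrp_A_sub] by blast
  qed
  have "cong_grp D (p ^ m) \<subseteq> cong_grp E (p ^ m)" for m
  proof
    fix x assume "x \<in> cong_grp D (p ^ m)"
    then obtain d z where dz: "d \<in> D" "x = d + nmul (p ^ m) z" by (rule cong_grpE)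
    then obtain e where "d - nmul (p ^ m) e \<in> E"
      using divisible_mod_power[OF div sE] by (auto simp: divisible_mod_def)
    then show "x \<in> cong_grp E (p ^ m)"
      by (rule cong_grpI[of _ _ _ _ "e + z"]) (simp add: dz(2) nmul_add)
  qed
  then have eq: "cong_grp E (p ^ m) = cong_grp D (p ^ m)" for m using cong_grp_mono[OF cD(2)] by blast
  show ?thesis
  proof (cases "D = UNIV")
    case True
    then show ?thesis using eq cong_grp_base by blast
  next
    case False
    then show ?thesis using D(1) eq by (auto simp: F_def)
  qed
qed blast

text \<open>Members of RJ_p inside E are handled by the chain; for those above E both sides are
  decided through r. The chain starts at u' r and needs congruences modulo E + p^m G, which
  \<open>cong_grp_next\<close> supplies when E is not in RJ_p.\<close>

lemma match_congruences_prime: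
  fixes u u' :: "'i \<Rightarrow> 'a::linordered_ab_group_add"
  assumes fin: "finite (RJn p (oag :: 'a ord_group))" and E: "convex_subgrp E" and p: "0 < p"
    and T: "finite T" and r: "r \<in> T" "x - u r \<in> E"
    and agree: "\<And>s t m D. s \<in> T \<Longrightarrow> t \<in> T \<Longrightarrow> m \<le> M \<Longrightarrow> D \<in> RJn p oag \<Longrightarrow>
      u s - u t \<in> cong_grp D (p ^ m) \<longleftrightarrow> u' s - u' t \<in> cong_grp D (p ^ m)"
  shows "\<exists>y. y - u' r \<in> E \<and> (\<forall>t\<in>T. \<forall>D\<in>RJn p oag. \<forall>m\<le>M.
    x - u t \<in> cong_grp D (p ^ m) \<longleftrightarrow> y - u' t \<in> cong_grp D (p ^ m))"
proof -
  have shift: "x - u t \<in> cong_grp D (p ^ m) \<longleftrightarrow> u r - u t \<in> cong_grp D (p ^ m)"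
    if "convex_subgrp D" "E \<subseteq> D" for D t m
    using subgrp_shift[OF subgrp_cong_grp[OF convex_subgrp_subgrp[OF that(1)]] cong_grp_base] r(2) that(2) by blast
  have hE: "x - u t \<in> cong_grp E (p ^ m) \<longleftrightarrow> u' r - u' t \<in> cong_grp E (p ^ m)" if "t \<in> T" "m \<le> M" for t m
    using cong_grp_next[OF fin E] agree[OF r(1) that] shift[OF E, of t m] by auto
  have "\<exists>y. y - u' r \<in> E \<and> (\<forall>t\<in>T. \<forall>D\<in>{D \<in> RJn p oag. D \<subseteq> E}. \<forall>m\<le>M.
    x - u t \<in> cong_grp D (p ^ m) \<longleftrightarrow> y - u' t \<in> cong_grp D (p ^ m))"
    by (rule match_congruences_chain) (use fin E p T agree hE convex_subgrp_RJn in auto)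
  then obtain y where y: "y - u' r \<in> E" "\<And>t D m. t \<in> T \<Longrightarrow> D \<in> RJn p oag \<Longrightarrow> D \<subseteq> E \<Longrightarrow> m \<le> M \<Longrightarrow>
    x - u t \<in> cong_grp D (p ^ m) \<longleftrightarrow> y - u' t \<in> cong_grp D (p ^ m)" by blast
  have "x - u t \<in> cong_grp D (p ^ m) \<longleftrightarrow> y - u' t \<in> cong_grp D (p ^ m)"
    if t: "t \<in> T" "D \<in> RJn p oag" "m \<le> M" for t D m
  proof (cases "D \<subseteq> E")
    case True
    then show ?thesis using y(2) t by blast
  next
    case False
    then have ED: "E \<subseteq> D" using convex_subgrp_linear[OF E convex_subgrp_RJn[OF t(2)]] by blast
    have "y - u' t \<in> cong_grp D (p ^ m) \<longleftrightarrow> u' r - u' t \<in> cong_grp D (p ^ m)"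
      using subgrp_shift[OF subgrp_cong_grp[OF convex_subgrp_subgrp[OF convex_subgrp_RJn[OF t(2)]]] cong_grp_base]
        y(1) ED by blast
    then show ?thesis using shift[OF convex_subgrp_RJn[OF t(2)] ED] agree[OF r(1) t(1,3,2)] by blast
  qed
  then show ?thesis using y(1) by blast
qed

section \<open>Matching a point over corresponding parameters\<close>

text \<open>Cosets of E are convex, so b outside a + E lies on the same side of every element of
  that coset.\<close>

lemma order_outside_coset:
  fixes x a b :: "'a::linordered_ab_group_add"
  assumes "convex_subgrp E" "x - a \<in> E" "a - b \<notin> E"
  shows "x \<le> b \<longleftrightarrow> a \<le> b" "b \<le> x \<longleftrightarrow> b \<le> a"
proof -
  note s = convex_subgrp_subgrp[OF assms(1)]
  have 1: False if "a \<le> b" "b \<le> x"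
  proof -
    have "b - a \<in> E" using that convex_subgrpD[OF assms(1,2), of "b - a"] by simp
    then show False using assms(3) subgrp_diff_commute[OF s] by blast
  qed
  have 2: False if "x \<le> b" "b \<le> a"
  proof -
    have "a - x \<in> E" using assms(2) subgrp_diff_commute[OF s] by blast
    then have "a - b \<in> E" using that convex_subgrpD[OF assms(1), of "a - x" "a - b"] by simp
    then show False using assms(3) by blast
  qed
  show "x \<le> b \<longleftrightarrow> a \<le> b" "b \<le> x \<longleftrightarrow> b \<le> a" using 1 2 by (meson linorder_linear)+
qed

text \<open>Modulo D nothing positive lies below c. Subtracting c while c \<le> y ends in D or at an
  element equal to c modulo D.\<close>

lemma discrete_multiples:
  fixes c :: "'a::linordered_ab_group_add"
  assumes D: "convex_subgrp D" and c: "\<And>y. 0 < y \<Longrightarrow> y \<notin> D \<Longrightarrow> \<exists>d\<in>D. c \<le> y + d"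
    and "0 \<le> y" "y \<le> nmul k c + d" "d \<in> D"
  shows "\<exists>j\<le>k. y - nmul j c \<in> D"
  using assms(3-)
proof (induction k arbitrary: y)
  case 0
  then show ?case using convex_subgrpD[OF D, of d y] by simp
next
  case (Suc k)
  note s = convex_subgrp_subgrp[OF D]
  show ?case
  proof (cases "y \<in> D")
    case True
    then show ?thesis by (intro exI[of _ 0]) simp
  next
    case False
    then have "0 < y" using Suc.prems(1) subgrpD(1)[OF s] by (auto simp: order_less_le)
    then obtain d' where d': "d' \<in> D" "c \<le> y + d'" using c False by blast
    show ?thesis
    proof (cases "c \<le> y")
      case True
      then obtain j where "j \<le> k" "y - c - nmul j c \<in> D"
        using Suc.IH[of "y - c"] Suc.prems by (auto simp: algebra_simps)
      then show ?thesis by (intro exI[of _ "Suc j"]) (simp add: algebra_simps)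
    next
      case False
      then have "c - y \<in> D" using convex_subgrpD[OF D d'(1), of "c - y"] d'(2) by (simp add: algebra_simps)
      then have "y - nmul 1 c \<in> D" using subgrp_diff_commute[OF s] by simp
      then show ?thesis by (intro exI[of _ 1]) simp
    qed
  qed
qed

text \<open>Halving: the smaller of z and e - z satisfies f + f \<le> e, and k + 1 \<le> 2 k once k
  \<ge> 1. The step from 0 to 1 is therefore separate.\<close>

lemma dense_division:
  fixes d :: "'a::linordered_ab_group_add"
  assumes D: "convex_subgrp D" and nd: "\<not> discrete_group (oquot oag D)" and d: "0 < d" "d \<notin> D"
  obtains e where "0 < e" "e \<notin> D" "nmul k e \<le> d"
proof -
  have "\<exists>e. 0 < e \<and> e \<notin> D \<and> nmul k e \<le> d"
  proof (induction k)
    case 0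
    then show ?case using d by auto
  next
    case (Suc k)
    then obtain e where e: "0 < e" "e \<notin> D" "nmul k e \<le> d" by blast
    show ?case
    proof (cases k)
      case 0
      then show ?thesis using d by (intro exI[of _ d]) simp
    next
      case (Suc l)
      obtain z where z: "0 < z" "z \<notin> D" "z < e" "e - z \<notin> D"
        using not_discrete_oquotD[OF D nd e(1,2)] .
      define f where "f = min z (e - z)"
      have f: "0 < f" "f \<notin> D" using z by (auto simp: f_def min_def)
      have "f + f \<le> z + (e - z)" by (intro add_mono) (auto simp: f_def)
      then have ff: "f + f \<le> e" by simp
      have "nmul (Suc k) f \<le> nmul (k + k) f" using f(1) Suc by (intro nmul_mono_left) auto
      also have "\<dots> = nmul k (f + f)" by (simp add: nmul_add_left nmul_add)
      also have "\<dots> \<le> nmul k e" by (rule nmul_mono[OF ff])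
      finally show ?thesis using f e(3) by (intro exI[of _ f]) auto
    qed
  qed
  then show thesis using that by blast
qed

lemma finite_arg_max:
  fixes f :: "'i \<Rightarrow> 'a::linorder"
  assumes "finite L" "L \<noteq> {}" obtains a where "a \<in> L" "\<And>t. t \<in> L \<Longrightarrow> f t \<le> f a"
proof -
  have "Max (f ` L) \<in> f ` L" using assms by (intro Max_in) auto
  then obtain a where "a \<in> L" "f a = Max (f ` L)" by force
  then show thesis using that[of a] assms(1) by simp
qed

lemma finite_arg_min:
  fixes f :: "'i \<Rightarrow> 'a::linorder"
  assumes "finite L" "L \<noteq> {}" obtains a where "a \<in> L" "\<And>t. t \<in> L \<Longrightarrow> f a \<le> f t"
proof -
  have "Min (f ` L) \<in> f ` L" using assms by (intro Min_in) auto
  then obtain a where "a \<in> L" "f a = Min (f ` L)" by force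
  then show thesis using that[of a] assms(1) by simp
qed


text \<open>The element \<open>e\<close> must fit \<open>n + 2\<close> times between the two neighbours of \<open>x\<close>. If it does not, then
  modulo \<open>D\<close> their distance is a small multiple of the least positive element \<open>c\<close>, hence so is the
  distance of \<open>x\<close> from the lower one.\<close>

lemma placement:
  fixes u u' :: "'i \<Rightarrow> 'a::linordered_ab_group_add"
  assumes D: "convex_subgrp D" and E: "convex_subgrp E" and DE: "D \<subset> E"
    and K: "finite K" and base: "\<And>t. t \<in> K \<Longrightarrow> u' t - b \<in> E"
    and le: "\<And>s t. s \<in> K \<Longrightarrow> t \<in> K \<Longrightarrow> u s \<le> u t \<longleftrightarrow> u' s \<le> u' t"
    and cg: "\<And>s t. s \<in> K \<Longrightarrow> t \<in> K \<Longrightarrow> u s - u t \<in> D \<longleftrightarrow> u' s - u' t \<in> D"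
    and xD: "\<And>t. t \<in> K \<Longrightarrow> x - u t \<notin> D"
    and const: "discrete_group (oquot oag D) \<Longrightarrow> least_positive (oquot oag D) (D #>\<^bsub>oag\<^esub> c)"
    and mult: "\<And>s t j. discrete_group (oquot oag D) \<Longrightarrow> s \<in> K \<Longrightarrow> t \<in> K \<Longrightarrow> j \<le> n + 2 \<Longrightarrow>
       u s - (u t + nmul j c) \<in> D \<longleftrightarrow> u' s - (u' t + nmul j c) \<in> D"
    and xmult: "\<And>t j. discrete_group (oquot oag D) \<Longrightarrow> t \<in> K \<Longrightarrow> j \<le> n + 2 \<Longrightarrow> x - (u t + nmul j c) \<notin> D"
  obtains a e where "0 < e" "e \<in> E" "e \<notin> D" "a - b \<in> E"
    "\<And>t. t \<in> K \<Longrightarrow> u t < x \<Longrightarrow> u' t + e \<le> a"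
    "\<And>t. t \<in> K \<Longrightarrow> x < u t \<Longrightarrow> a + nmul n e + e \<le> u' t"
proof -
  note sD = convex_subgrp_subgrp[OF D] and sE = convex_subgrp_subgrp[OF E]
  define L where "L = {t \<in> K. u t < x}"
  define U where "U = {t \<in> K. x < u t}"
  have fin: "finite L" "finite U" using K by (auto simp: L_def U_def)
  obtain e0 where e0: "0 < e0" "e0 \<in> E" "e0 \<notin> D"
  proof -
    obtain e where e: "e \<in> E" "e \<notin> D" using DE by blast
    then have "max e (- e) \<in> E" "max e (- e) \<notin> D" using convex_subgrp_max D E by blast+
    moreover from this have "max e (- e) \<noteq> 0" using subgrpD(1)[OF sD] by metis
    then have "0 < max e (- e)" using max_minus_nonneg[of e] by (simp only: order_less_le) simp
    ultimately show thesis using that by blast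
  qed
  \<comment> \<open>Without a neighbour on one side there is room there, and any positive
    \<open>e0\<close> of E outside D serves as step.\<close>
  consider "U = {}" "L = {}" | "U = {}" "L \<noteq> {}" | "U \<noteq> {}" "L = {}" | "U \<noteq> {}" "L \<noteq> {}" by blast
  then show thesis
  proof cases
    case 1
    then show thesis using that[of e0 b] e0 subgrpD(1)[OF sE] by (auto simp: L_def U_def)
  next
    case 2
    obtain l where l: "l \<in> L" "\<And>t. t \<in> L \<Longrightarrow> u' t \<le> u' l" using finite_arg_max[OF fin(1) 2(2)] by blast
    have "(u' l - b) + e0 \<in> E" using l(1) base e0(2) subgrpD(2)[OF sE] by (simp add: L_def)
    then have "(u' l + e0) - b \<in> E" by (simp add: algebra_simps)
    then show thesis using that[of e0 "u' l + e0"] e0 l 2(1) by (auto simp: L_def U_def)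
  next
    case 3
    obtain r where r: "r \<in> U" "\<And>t. t \<in> U \<Longrightarrow> u' r \<le> u' t" using finite_arg_min[OF fin(2) 3(1)] by blast
    have "(u' r - b) - (nmul n e0 + e0) \<in> E"
      using r(1) base subgrpD(4)[OF sE _ subgrpD(2)[OF sE subgrp_nmul[OF sE e0(2)] e0(2)]] by (simp add: U_def)
    then have "(u' r - (nmul n e0 + e0)) - b \<in> E" by (simp add: algebra_simps)
    then show thesis using that[of e0 "u' r - (nmul n e0 + e0)"] e0 r 3(2) by (auto simp: L_def U_def add.assoc)
  next
    case 4
    obtain l where l: "l \<in> L" "\<And>t. t \<in> L \<Longrightarrow> u' t \<le> u' l" using finite_arg_max[OF fin(1) 4(2)] by blast
    obtain r where r: "r \<in> U" "\<And>t. t \<in> U \<Longrightarrow> u' r \<le> u' t" using finite_arg_min[OF fin(2) 4(1)] by blast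
    have K': "l \<in> K" "r \<in> K" and x: "u l < x" "x < u r" using l r by (auto simp: L_def U_def)
    define d where "d = u' r - u' l"
    have "u r - u l \<notin> D"
    proof
      assume "u r - u l \<in> D"
      then have "x - u l \<in> D" using x by (intro convex_subgrpD[OF D \<open>u r - u l \<in> D\<close>]) auto
      then show False using xD K' by blast
    qed
    then have dD: "d \<notin> D" using cg K' by (simp add: d_def)
    have "\<not> u r \<le> u l" using x by auto
    then have "\<not> u' r \<le> u' l" using le K' by blast
    then have d0: "0 < d" by (simp add: d_def)
    have dE: "d \<in> E" using subgrpD(4)[OF sE base[OF K'(2)] base[OF K'(1)]] by (simp add: d_def)
    \<comment> \<open>n + 2 steps: one from u' l up to a, n for the interval starting at a, one from
      its end to u' r.\<close>
    have "\<exists>e. 0 < e \<and> e \<notin> D \<and> nmul (n + 2) e \<le> d"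
    proof (cases "discrete_group (oquot oag D)")
      case False
      then show ?thesis using dense_division[OF D False d0 dD] by metis
    next
      case True
      note c = least_positive_oquotD[OF D const[OF True]]
      show ?thesis
      proof (cases "nmul (n + 2) c \<le> d")
        case True
        then show ?thesis using c by blast
      next
        case False
        then have "d \<le> nmul (n + 2) c + 0" by (simp only: add_0_right not_le less_imp_le)
        have "\<exists>j\<le>n + 2. d - nmul j c \<in> D"
          by (rule discrete_multiples[OF D c(3) less_imp_le[OF d0] \<open>d \<le> _\<close> subgrpD(1)[OF sD]])
        then obtain j where j: "j \<le> n + 2" "d - nmul j c \<in> D" by blast
        \<comment> \<open>x lives on the side of u, so the relation found for d is carried back by
          \<open>mult\<close> before x is squeezed in.\<close>
        then have "u r - (u l + nmul j c) \<in> D"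
          using mult[OF True K'(2,1) j(1)] by (simp add: d_def algebra_simps)
        then have "u r - u l - nmul j c \<in> D" by (simp add: algebra_simps)
        have "x - u l \<le> nmul j c + (u r - u l - nmul j c)" "0 \<le> x - u l" using x by simp_all
        from discrete_multiples[OF D c(3) this(2,1) \<open>u r - u l - nmul j c \<in> D\<close>]
        obtain i where "i \<le> j" "x - u l - nmul i c \<in> D" by blast
        then have "x - (u l + nmul i c) \<in> D" "i \<le> n + 2" using j by (auto simp: algebra_simps)
        then show ?thesis using xmult[OF True K'(1)] by blast
      qed
    qed
    then obtain e where e: "0 < e" "e \<notin> D" "nmul (n + 2) e \<le> d" by blast
    have "e \<le> d" by (rule order_trans[OF nmul_ge_self e(3)]) (use e(1) in auto)
    then have eE: "e \<in> E" using convex_subgrpD[OF E dE] e(1) by simp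
    have "(u' l - b) + e \<in> E" using K' base eE subgrpD(2)[OF sE] by simp
    then have 1: "(u' l + e) - b \<in> E" by (simp add: algebra_simps)
    have 2: "u' l + e + nmul n e + e \<le> u' r"
      using e(3) by (simp add: d_def nmul_add_left algebra_simps)
    show thesis
      by (rule that[OF e(1) eE e(2) 1]) (use l r 2 in \<open>auto simp: L_def U_def intro: order_trans\<close>)
  qed
qed

text \<open>T holds the parameters to be compared with x, T' also their translates by multiples of
  the constants. E is chosen over T', which excludes that x meets a translate modulo D; the
  conclusion is drawn for T only, since only elements of T are assumed to have translates.\<close>

lemma extend_point:
  fixes u u' :: "'i \<Rightarrow> 'a::linordered_ab_group_add" and c :: "'a set \<Rightarrow> 'a"
  assumes S: "finite S" "{0} \<in> S" "\<And>D. D \<in> S \<Longrightarrow> convex_subgrp D"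
    and P: "finite P" "\<And>p. p \<in> P \<Longrightarrow> prime p" "\<And>p. p \<in> P \<Longrightarrow> RJn p oag \<subseteq> S"
    and n: "n = (\<Prod>p\<in>P. p ^ M)"
    and const: "\<And>D. D \<in> S \<Longrightarrow> discrete_group (oquot oag D) \<Longrightarrow>
      least_positive (oquot oag D) (D #>\<^bsub>oag\<^esub> c D)"
    and T: "finite T'" "T \<subseteq> T'" "T \<noteq> {}"
    and shift: "\<And>t D j. t \<in> T \<Longrightarrow> D \<in> S \<Longrightarrow> discrete_group (oquot oag D) \<Longrightarrow> j \<le> n + 2 \<Longrightarrow>
      \<exists>s\<in>T'. u s = u t + nmul j (c D) \<and> u' s = u' t + nmul j (c D)"
    and le: "\<And>s t. s \<in> T' \<Longrightarrow> t \<in> T' \<Longrightarrow> u s \<le> u t \<longleftrightarrow> u' s \<le> u' t"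
    and cg: "\<And>s t D. s \<in> T' \<Longrightarrow> t \<in> T' \<Longrightarrow> D \<in> S \<Longrightarrow> u s - u t \<in> D \<longleftrightarrow> u' s - u' t \<in> D"
    and cp: "\<And>s t p D m. s \<in> T' \<Longrightarrow> t \<in> T' \<Longrightarrow> p \<in> P \<Longrightarrow> D \<in> RJn p oag \<Longrightarrow> m \<le> M \<Longrightarrow>
      u s - u t \<in> cong_grp D (p ^ m) \<longleftrightarrow> u' s - u' t \<in> cong_grp D (p ^ m)"
  obtains y where
    "\<And>t. t \<in> T \<Longrightarrow> x \<le> u t \<longleftrightarrow> y \<le> u' t" "\<And>t. t \<in> T \<Longrightarrow> u t \<le> x \<longleftrightarrow> u' t \<le> y"
    "\<And>t D. t \<in> T \<Longrightarrow> D \<in> S \<Longrightarrow> x - u t \<in> D \<longleftrightarrow> y - u' t \<in> D"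
    "\<And>t p D m. t \<in> T \<Longrightarrow> p \<in> P \<Longrightarrow> D \<in> RJn p oag \<Longrightarrow> m \<le> M \<Longrightarrow>
      x - u t \<in> cong_grp D (p ^ m) \<longleftrightarrow> y - u' t \<in> cong_grp D (p ^ m)"
proof -
  \<comment> \<open>\<open>UNIV\<close> makes F nonempty, since every x - u s lies in it.\<close>
  define F where "F = {D \<in> insert UNIV S. \<exists>s\<in>T'. x - u s \<in> D}"
  have cF: "convex_subgrp D" if "D \<in> F" for D
    using that S(3)[of D] unfolding F_def by fastforce
  have "finite F" using S(1) by (simp add: F_def)
  moreover have "UNIV \<in> F" using T(2,3) unfolding F_def by blast
  then have "F \<noteq> {}" by blast
  ultimately obtain E where E: "E \<in> F" "\<And>D. D \<in> F \<Longrightarrow> E \<subseteq> D"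
    using cF by (rule finite_chain_least) (assumption, rule that)
  then obtain r where r: "r \<in> T'" "x - u r \<in> E" by (auto simp: F_def)
  have cE: "convex_subgrp E" using E(1) S(3) by (auto simp: F_def)
  note sE = convex_subgrp_subgrp[OF cE]
  have cgE: "u s - u t \<in> E \<longleftrightarrow> u' s - u' t \<in> E" if "s \<in> T'" "t \<in> T'" for s t
    using E(1) cg[OF that] by (auto simp: F_def)
  show thesis
  \<comment> \<open>Here x equals a parameter, and the corresponding one is the answer.\<close>
  proof (cases "E = {0}")
    case True
    then have "x = u r" using r by simp
    then show thesis using that[of "u' r"] le[OF r(1)] le[OF _ r(1)] cg[OF r(1)] cp[OF r(1)] T(2) by blast
  next
    case False
    have "0 \<in> E" using subgrpD(1)[OF sE] .
    define F' where "F' = {D \<in> S. D \<subset> E}"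
    have cF': "convex_subgrp D" if "D \<in> F'" for D
      using that S(3)[of D] unfolding F'_def by blast
    have "finite F'" using S(1) by (simp add: F'_def)
    moreover have "{0} \<in> F'" using S(2) False \<open>0 \<in> E\<close> unfolding F'_def by blast
    then have "F' \<noteq> {}" by blast
    ultimately obtain D where D: "D \<in> F'" "\<And>C. C \<in> F' \<Longrightarrow> C \<subseteq> D"
      using cF' by (rule finite_chain_greatest) (assumption, rule that)
    have DS: "D \<in> S" and DE: "D \<subset> E" using D(1) by (auto simp: F'_def)
    have cD: "convex_subgrp D" using S(3) DS by blast
    note sD = convex_subgrp_subgrp[OF cD]
    have xD: "x - u s \<notin> D" if "s \<in> T'" for s
      using that DE E(2)[of D] DS by (auto simp: F_def)
    \<comment> \<open>K collects the parameters in the coset of E containing x; the order position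
      of all others is decided through r.\<close>
    define K where "K = {t \<in> T. u t - u r \<in> E}"
    have "finite K" and KT: "\<And>t. t \<in> K \<Longrightarrow> t \<in> T'" using T finite_subset[OF _ T(1), of K] by (auto simp: K_def)
    have base: "u' t - u' r \<in> E" if "t \<in> K" for t
      using that cgE[OF KT[OF that] r(1)] by (simp add: K_def)
    have mult: "u s - (u t + nmul j (c D)) \<in> D \<longleftrightarrow> u' s - (u' t + nmul j (c D)) \<in> D"
      if dt: "discrete_group (oquot oag D)" "s \<in> K" "t \<in> K" "j \<le> n + 2" for s t j
    proof -
      have "t \<in> T" using dt(3) by (simp add: K_def)
      then obtain t' where t': "t' \<in> T'" "u t' = u t + nmul j (c D)" "u' t' = u' t + nmul j (c D)"
        using shift[OF _ DS dt(1,4), of t] by blast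
      show ?thesis using cg[OF KT[OF dt(2)] t'(1) DS] unfolding t' .
    qed
    have xmult: "x - (u t + nmul j (c D)) \<notin> D"
      if dt: "discrete_group (oquot oag D)" "t \<in> K" "j \<le> n + 2" for t j
    proof -
      have "t \<in> T" using dt(2) by (simp add: K_def)
      then obtain t' where t': "t' \<in> T'" "u t' = u t + nmul j (c D)" 
        using shift[OF _ DS dt(1,3), of t] by blast
      show ?thesis using xD[OF t'(1)] unfolding t' .
    qed
    obtain a e where ae: "0 < e" "e \<in> E" "e \<notin> D" "a - u' r \<in> E"
      "\<And>t. t \<in> K \<Longrightarrow> u t < x \<Longrightarrow> u' t + e \<le> a"
      "\<And>t. t \<in> K \<Longrightarrow> x < u t \<Longrightarrow> a + nmul n e + e \<le> u' t"
      by (rule placement[OF cD cE DE \<open>finite K\<close> base le[OF KT KT] cg[OF KT KT DS] xD[OF KT]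
            const[OF DS] mult xmult]) (assumption+, rule that)
    have "\<exists>hp. \<forall>p\<in>P. hp p - u' r \<in> E \<and> (\<forall>t\<in>T'. \<forall>D\<in>RJn p oag. \<forall>m\<le>M.
      x - u t \<in> cong_grp D (p ^ m) \<longleftrightarrow> hp p - u' t \<in> cong_grp D (p ^ m))"
    proof (rule bchoice, rule ballI)
      fix p assume p: "p \<in> P"
      show "\<exists>y. y - u' r \<in> E \<and> (\<forall>t\<in>T'. \<forall>D\<in>RJn p oag. \<forall>m\<le>M.
        x - u t \<in> cong_grp D (p ^ m) \<longleftrightarrow> y - u' t \<in> cong_grp D (p ^ m))"
        using cp p finite_subset[OF P(3)[OF p] S(1)] prime_gt_0_nat[OF P(2)[OF p]]
        by (intro match_congruences_prime cE T(1) r) auto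
    qed
    then obtain hp where hp: "\<And>p. p \<in> P \<Longrightarrow> hp p - u' r \<in> E"
      "\<And>p t D m. p \<in> P \<Longrightarrow> t \<in> T' \<Longrightarrow> D \<in> RJn p oag \<Longrightarrow> m \<le> M \<Longrightarrow>
        x - u t \<in> cong_grp D (p ^ m) \<longleftrightarrow> hp p - u' t \<in> cong_grp D (p ^ m)" by blast
    have "\<exists>h. h - u' r \<in> E \<and> (\<forall>p\<in>P. \<exists>z\<in>E. h - hp p = nmul (p ^ M) z)"
      by (rule crt_family[OF P(1)]) (fact P(2) sE hp(1))+
    then obtain h where h: "h - u' r \<in> E" "\<And>p. p \<in> P \<Longrightarrow> \<exists>z\<in>E. h - hp p = nmul (p ^ M) z"
      by blast
    have "n > 0" unfolding n using P(2) prime_gt_0_nat by (intro prod_pos) auto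
    \<comment> \<open>Members of RJ_p properly inside E are contained in D, and
      \<open>conv_hull e\<close> is strictly above D since e \<notin> D. So no jump remains between
      \<open>conv_hull e\<close> and E.\<close>
    have "divisible_mod n E (conv_hull e)"
      unfolding n
    proof (intro divisible_mod_prod P(1) divisible_mod_power convex_subgrp_subgrp convex_subgrp_conv_hull)
      fix p assume p: "p \<in> P"
      show "divisible_mod p E (conv_hull e)"
      proof (rule divisible_mod_A_sub[OF convex_subgrp_conv_hull cE])
        fix g assume g: "g \<in> E" "g \<notin> conv_hull e"
        then have "g \<noteq> 0" using subgrpD(1)[OF convex_subgrp_subgrp[OF convex_subgrp_conv_hull]] by auto
        then have A: "A_sub p oag g \<in> S" "g \<notin> A_sub p oag g"
          using P(3)[OF p] notin_A_sub by (auto simp: RJn_oag)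
        then have "A_sub p oag g \<subset> E" using convex_subgrp_linear[OF cE convex_subgrp_A_sub] g(1) by blast
        then have "A_sub p oag g \<subseteq> D" using D(2) A by (auto simp: F'_def)
        moreover have "D \<subset> conv_hull e"
          using convex_subgrp_linear[OF cD convex_subgrp_conv_hull[of e]] conv_hull_self[of e] ae(3) by blast
        ultimately show "A_sub p oag g \<subset> conv_hull e" by blast
      qed
    qed
    moreover have "h - a \<in> E" using subgrpD(4)[OF sE h(1) ae(4)] by simp
    ultimately obtain y z where y: "a \<le> y" "y < a + nmul n e" "z \<in> E" "y - h = nmul n z"
      using interval_meets_class[OF sE ae(2,1) \<open>n > 0\<close>] by blast
    have "(y - h) + (h - u' r) \<in> E"
      using subgrpD(2)[OF sE _ h(1)] subgrp_nmul[OF sE y(3)] y(4) by simp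
    then have yr: "y - u' r \<in> E" by simp
    have cong: "x - u t \<in> cong_grp C (p ^ m) \<longleftrightarrow> y - u' t \<in> cong_grp C (p ^ m)"
      if t: "t \<in> T" "p \<in> P" "C \<in> RJn p oag" "m \<le> M" for t p C m
    proof -
      note sC = convex_subgrp_subgrp[OF convex_subgrp_RJn[OF t(3)]]
      obtain w where w: "h - hp p = nmul (p ^ M) w" using h(2) t(2) by blast
      have "p ^ M dvd n" unfolding n using t(2) P(1) by (rule dvd_prodI[rotated])
      then obtain k where "n = p ^ M * k" by (rule dvdE)
      then have "nmul n z = nmul (p ^ M) (nmul k z)" by (simp only: nmul_mult)
      then have "y - hp p = nmul (p ^ M) (w + nmul k z)"
        using w y(4) by (simp add: nmul_add algebra_simps)
      then have "y - hp p \<in> cong_grp C (p ^ m)"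
        by (simp only:) (rule subsetD[OF cong_grp_antimono[OF le_imp_power_dvd[OF t(4)]] cong_grp_mult[OF sC]])
      then show ?thesis
        using hp(2)[OF t(2) _ t(3,4), of t] t(1) T(2) subgrp_shift[OF subgrp_cong_grp[OF sC]] by blast
    qed
    \<comment> \<open>y keeps a distance of at least e from each parameter of K. As e \<notin> D, it
      stays on the right side and incongruent modulo D, as x does.\<close>
    have near: "(u t < x \<longrightarrow> u' t < y) \<and> (x < u t \<longrightarrow> y < u' t) \<and> y - u' t \<notin> D" if t: "t \<in> K" for t
    proof -
      have "x \<noteq> u t" using xD[OF KT[OF t]] subgrpD(1)[OF sD] by auto
      then consider "u t < x" | "x < u t" by fastforce
      then show ?thesis
      proof cases
        case 1
        have ey: "e \<le> y - u' t" using ae(5)[OF t 1] y(1) by (metis add.commute le_diff_eq order_trans)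
        then have "u' t < y" using ae(1) by (metis diff_gt_0_iff_gt order_less_le_trans)
        moreover have "y - u' t \<notin> D" using ae(3) convex_subgrpD[OF cD _ less_imp_le[OF ae(1)] ey] by blast
        ultimately show ?thesis using 1 by auto
      next
        case 2
        have "y + e \<le> a + nmul n e + e" using y(2) by simp
        then have ey: "e \<le> u' t - y" using ae(6)[OF t 2] by (metis add.commute le_diff_eq order_trans)
        then have "y < u' t" using ae(1) by (metis diff_gt_0_iff_gt order_less_le_trans)
        moreover have "u' t - y \<notin> D" using ae(3) convex_subgrpD[OF cD _ less_imp_le[OF ae(1)] ey] by blast
        then have "y - u' t \<notin> D" using subgrp_diff_commute[OF sD] by blast
        ultimately show ?thesis using 2 by auto
      qed
    qed
    have far: "u r - u t \<notin> E" "u' r - u' t \<notin> E" if "t \<in> T" "t \<notin> K" for t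
    proof -
      show "u r - u t \<notin> E" using that subgrp_diff_commute[OF sE] by (auto simp: K_def)
      then show "u' r - u' t \<notin> E" using cgE[OF r(1)] that(1) T(2) by blast
    qed
    show thesis
    proof (rule that[of y])
      fix t assume t: "t \<in> T"
      then have t': "t \<in> T'" using T(2) by blast
      have "(x \<le> u t \<longleftrightarrow> y \<le> u' t) \<and> (u t \<le> x \<longleftrightarrow> u' t \<le> y)"
      proof (cases "t \<in> K")
        case True
        have "x \<noteq> u t" using xD[OF t'] subgrpD(1)[OF sD] by auto
        then show ?thesis using near[OF True] by (metis less_le_not_le linorder_neqE order.strict_implies_order)
      next
        case False
        show ?thesis
          using order_outside_coset[OF cE r(2) far(1)[OF t False]] order_outside_coset[OF cE yr far(2)[OF t False]]
            le[OF r(1) t'] le[OF t' r(1)] by blast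
      qed
      then show "x \<le> u t \<longleftrightarrow> y \<le> u' t" "u t \<le> x \<longleftrightarrow> u' t \<le> y" by blast+
    next
      fix t C assume t: "t \<in> T" and C: "C \<in> S"
      then have t': "t \<in> T'" using T(2) by blast
      note sC = convex_subgrp_subgrp[OF S(3)[OF C]]
      show "x - u t \<in> C \<longleftrightarrow> y - u' t \<in> C"
      proof (cases "E \<subseteq> C")
        case True
        then have "x - u r \<in> C" "y - u' r \<in> C" using r(2) yr by auto
        then show ?thesis using subgrp_shift[OF sC] cg[OF r(1) t' C] by blast
      next
        case False
        then have "C \<subset> E" using convex_subgrp_linear[OF cE S(3)[OF C]] by blast
        \<comment> \<open>C is inside D, where both sides of the equivalence are false.\<close>
        then have CD: "C \<subseteq> D" using D(2) C by (auto simp: F'_def)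
        have "x - u t \<notin> D" using xD[OF t'] .
        moreover have "y - u' t \<notin> D"
        proof (cases "t \<in> K")
          case True
          then show ?thesis using near by blast
        next
          case False
          then have "y - u' t \<notin> E" using subgrp_shift[OF sE yr] far(2)[OF t] by blast
          then show ?thesis using DE by blast
        qed
        ultimately show ?thesis using CD by blast
      qed
    qed (rule cong)
  qed
qed

section \<open>Terms and atoms\<close>

lemma cong_grp_zero_iff: "x \<in> cong_grp {0} k \<longleftrightarrow> (\<exists>z. x = nmul k z)"
  by (auto simp: cong_grp_def)

text \<open>Split N = b p^a. By Bezout x is a combination of b x and p^a x; writing x as a multiple
  of p^a in the first and of b in the second makes both terms multiples of N.\<close>

lemma cong_grp_zero_prime_powers:
  assumes "0 < N" "\<And>p m. prime p \<Longrightarrow> p ^ m dvd N \<Longrightarrow> x \<in> cong_grp {0} (p ^ m)"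
  shows "x \<in> cong_grp {0} N"
  using assms
proof (induction N rule: less_induct)
  case (less N)
  show ?case
  proof (cases "N = 1")
    case True
    then show ?thesis by (simp add: cong_grp_zero_iff)
  next
    case False
    then obtain p where p: "prime p" "p dvd N" using prime_factor_nat by blast
    obtain a b where ab: "\<not> p dvd b" "N = b * p ^ a"
      using prime_power_canonical[OF p(1) less.prems(1)] by blast
    then have "0 < a" using p(2) by (cases a) auto
    then have "1 < p ^ a" using prime_gt_1_nat[OF p(1)] \<open>0 < a\<close> by (intro one_less_power)
    then have "b < N" "0 < b" using ab(2) less.prems(1) by auto
    moreover have "x \<in> cong_grp {0} (q ^ m)" if "prime q" "q ^ m dvd b" for q m
      using less.prems(2)[OF that(1)] that(2) ab(2) by simp
    ultimately have "x \<in> cong_grp {0} b" using less.IH by blast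
    then obtain z where z: "x = nmul b z" by (auto simp: cong_grp_zero_iff)
    have "x \<in> cong_grp {0} (p ^ a)" using less.prems(2)[OF p(1)] ab(2) by simp
    then obtain y where y: "x = nmul (p ^ a) y" by (auto simp: cong_grp_zero_iff)
    have "coprime b (p ^ a)" using ab(1) p(1)
      by (metis coprime_commute coprime_power_right_iff prime_imp_coprime)
    then obtain u v where "x = nmul b (nmul u x) + nmul (p ^ a) (- nmul v x) \<or>
        x = nmul b (- nmul u x) + nmul (p ^ a) (nmul v x)" by (rule bezout_nmul)
    moreover have "nmul b (nmul u x) = nmul N (nmul u y)" 
    proof -
      have "nmul u x = nmul (p ^ a) (nmul u y)" unfolding y by (rule nmul_commute)
      then show ?thesis by (simp only: ab(2) nmul_mult)
    qed
    moreover have "nmul (p ^ a) (nmul v x) = nmul N (nmul v z)"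
    proof -
      have "nmul v x = nmul b (nmul v z)" unfolding z by (rule nmul_commute)
      then show ?thesis by (simp only: ab(2) mult.commute[of b] nmul_mult)
    qed
    ultimately have "x = nmul N (nmul u y - nmul v z) \<or> x = nmul N (nmul v z - nmul u y)"
      by (auto simp: nmul_diff nmul_minus)
    then show ?thesis by (auto simp: cong_grp_zero_iff)
  qed
qed

section \<open>Coefficients of a variable in terms and atoms\<close>

primrec smult :: "nat \<Rightarrow> 'a tm \<Rightarrow> 'a tm" where
  "smult 0 t = Zero"
| "smult (Suc n) t = Plus t (smult n t)"

lemma tm_val_smult: "tm_val c e (smult n t) = nmul n (tm_val c e t)"
  by (induction n) auto

lemma L_term_smult: "L_term t \<Longrightarrow> L_term (smult n t)"
  by (induction n) auto

lemma tm_vars_smult: "tm_vars (smult n t) \<subseteq> tm_vars t"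
  by (induction n) auto

text \<open>The positive and the negative occurrences of a variable in a term are counted separately,
  so that coefficients stay natural numbers.\<close>

primrec occurrences :: "nat \<Rightarrow> 'a tm \<Rightarrow> nat \<times> nat" where
  "occurrences i (Var j) = (if i = j then (1, 0) else (0, 0))"
| "occurrences i Zero = (0, 0)"
| "occurrences i (Plus s t) =
     (fst (occurrences i s) + fst (occurrences i t), snd (occurrences i s) + snd (occurrences i t))"
| "occurrences i (Minus t) = (snd (occurrences i t), fst (occurrences i t))"
| "occurrences i (One D) = (0, 0)"

primrec erase :: "nat \<Rightarrow> 'a tm \<Rightarrow> 'a tm" where
  "erase i (Var j) = (if i = j then Zero else Var j)"
| "erase i Zero = Zero"
| "erase i (Plus s t) = Plus (erase i s) (erase i t)"
| "erase i (Minus t) = Minus (erase i t)"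
| "erase i (One D) = One D"

lemma tm_val_erase:
  "tm_val c (e(i := x)) t =
     nmul (fst (occurrences i t)) x - nmul (snd (occurrences i t)) x + tm_val c e (erase i t)"
  by (induction t) (auto simp: nmul_add_left algebra_simps)

lemma L_term_erase: "L_term t \<Longrightarrow> L_term (erase i t)"
  by (induction t) auto

lemma tm_vars_erase: "tm_vars (erase i t) = tm_vars t - {i}"
  by (induction t) auto

primrec atoms :: "'a fm \<Rightarrow> 'a fm set" where
  "atoms (Eq s t) = {Eq s t}"
| "atoms (Le s t) = {Le s t}"
| "atoms (Cong D s t) = {Cong D s t}"
| "atoms (CongPow D p m s t) = {CongPow D p m s t}"
| "atoms (Neg \<phi>) = atoms \<phi>"
| "atoms (Conj \<phi> \<psi>) = atoms \<phi> \<union> atoms \<psi>"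
| "atoms (Ex i \<phi>) = atoms \<phi>"

primrec is_atom :: "'a fm \<Rightarrow> bool" where
  "is_atom (Eq s t) \<longleftrightarrow> True"
| "is_atom (Le s t) \<longleftrightarrow> True"
| "is_atom (Cong D s t) \<longleftrightarrow> True"
| "is_atom (CongPow D p m s t) \<longleftrightarrow> True"
| "is_atom (Neg \<phi>) \<longleftrightarrow> False"
| "is_atom (Conj \<phi> \<psi>) \<longleftrightarrow> False"
| "is_atom (Ex i \<phi>) \<longleftrightarrow> False"

primrec lhs :: "'a fm \<Rightarrow> 'a tm" where
  "lhs (Eq s t) = s"
| "lhs (Le s t) = s"
| "lhs (Cong D s t) = s"
| "lhs (CongPow D p m s t) = s"
| "lhs (Neg \<phi>) = Zero"
| "lhs (Conj \<phi> \<psi>) = Zero"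
| "lhs (Ex i \<phi>) = Zero"

primrec rhs :: "'a fm \<Rightarrow> 'a tm" where
  "rhs (Eq s t) = t"
| "rhs (Le s t) = t"
| "rhs (Cong D s t) = t"
| "rhs (CongPow D p m s t) = t"
| "rhs (Neg \<phi>) = Zero"
| "rhs (Conj \<phi> \<psi>) = Zero"
| "rhs (Ex i \<phi>) = Zero"

primrec erase_atom :: "nat \<Rightarrow> 'a fm \<Rightarrow> 'a fm" where
  "erase_atom i (Eq s t) = Eq (erase i s) (erase i t)"
| "erase_atom i (Le s t) = Le (erase i s) (erase i t)"
| "erase_atom i (Cong D s t) = Cong D (erase i s) (erase i t)"
| "erase_atom i (CongPow D p m s t) = CongPow D p m (erase i s) (erase i t)"
| "erase_atom i (Neg \<phi>) = Neg \<phi>"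
| "erase_atom i (Conj \<phi> \<psi>) = Conj \<phi> \<psi>"
| "erase_atom i (Ex j \<phi>) = Ex j \<phi>"

text \<open>A \<open>CongPow\<close> atom of the language contributes no subgroup here: its subgroup
  belongs to \<open>RJn p oag\<close> and is reached through its prime.\<close>

primrec atom_groups :: "'a fm \<Rightarrow> 'a set set" where
  "atom_groups (Eq s t) = {}"
| "atom_groups (Le s t) = {}"
| "atom_groups (Cong D s t) = {D}"
| "atom_groups (CongPow D p m s t) = {}"
| "atom_groups (Neg \<phi>) = {}"
| "atom_groups (Conj \<phi> \<psi>) = {}"
| "atom_groups (Ex i \<phi>) = {}"

primrec atom_primes :: "'a fm \<Rightarrow> nat set" where
  "atom_primes (Eq s t) = {}"
| "atom_primes (Le s t) = {}"
| "atom_primes (Cong D s t) = {}"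
| "atom_primes (CongPow D p m s t) = {p}"
| "atom_primes (Neg \<phi>) = {}"
| "atom_primes (Conj \<phi> \<psi>) = {}"
| "atom_primes (Ex i \<phi>) = {}"

primrec atom_exponent :: "'a fm \<Rightarrow> nat" where
  "atom_exponent (Eq s t) = 0"
| "atom_exponent (Le s t) = 0"
| "atom_exponent (Cong D s t) = 0"
| "atom_exponent (CongPow D p m s t) = m"
| "atom_exponent (Neg \<phi>) = 0"
| "atom_exponent (Conj \<phi> \<psi>) = 0"
| "atom_exponent (Ex i \<phi>) = 0"

lemma finite_atoms: "finite (atoms \<phi>)"
  by (induction \<phi>) auto

lemma is_atom_atoms: "a \<in> atoms \<phi> \<Longrightarrow> is_atom a"
  by (induction \<phi>) auto

lemma L_formula_atoms: "L_formula \<phi> \<Longrightarrow> a \<in> atoms \<phi> \<Longrightarrow> L_formula a"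
  by (induction \<phi>) auto

lemma free_vars_atoms: "quantifier_free \<phi> \<Longrightarrow> a \<in> atoms \<phi> \<Longrightarrow> free_vars a \<subseteq> free_vars \<phi>"
  by (induction \<phi>) auto

lemma sat_atoms_cong:
  "quantifier_free \<phi> \<Longrightarrow> (\<And>a. a \<in> atoms \<phi> \<Longrightarrow> sat c e a \<longleftrightarrow> sat c e' a) \<Longrightarrow> sat c e \<phi> \<longleftrightarrow> sat c e' \<phi>"
  by (induction \<phi>) auto

lemma sat_CongPow_iff:
  "sat c e (CongPow D p m s t) \<longleftrightarrow> tm_val c e s - tm_val c e t \<in> cong_grp D (p ^ m)"
  by (simp add: cong_grp_def nmul_pow_oag)

text \<open>The occurrences of the variable balance, so x cancels in the difference of the two
  sides, and each kind of atom depends on that difference alone.\<close>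

lemma sat_erase_atom:
  assumes "is_atom a" "fst (occurrences i (lhs a)) + snd (occurrences i (rhs a)) =
      snd (occurrences i (lhs a)) + fst (occurrences i (rhs a))"
  shows "sat c (e(i := x)) a \<longleftrightarrow> sat c e (erase_atom i a)"
proof -
  have "nmul (fst (occurrences i (lhs a)) + snd (occurrences i (rhs a))) x =
      nmul (snd (occurrences i (lhs a)) + fst (occurrences i (rhs a))) x" using assms(2) by simp
  then have eq: "tm_val c (e(i := x)) (lhs a) - tm_val c (e(i := x)) (rhs a) =
      tm_val c e (erase i (lhs a)) - tm_val c e (erase i (rhs a))"
    by (simp add: tm_val_erase nmul_add_left algebra_simps)
  have "tm_val c (e(i := x)) (lhs a) \<le> tm_val c (e(i := x)) (rhs a) \<longleftrightarrow>
      tm_val c e (erase i (lhs a)) \<le> tm_val c e (erase i (rhs a))"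
    using eq by (metis diff_le_0_iff_le)
  moreover have "tm_val c (e(i := x)) (lhs a) = tm_val c (e(i := x)) (rhs a) \<longleftrightarrow>
      tm_val c e (erase i (lhs a)) = tm_val c e (erase i (rhs a))"
    using eq by (metis right_minus_eq)
  ultimately show ?thesis using assms(1) eq by (cases a) simp_all
qed

text \<open>An atom depends only on the difference v of its sides, and can be read off from l v:
  order by monotonicity, membership in D by purity, congruences by raising the exponent. The sign
  pattern in \<open>w\<close> is common to both assignments, so an inequality is never reversed on
  one side only.\<close>

lemma atom_transfer:
  fixes v v' :: "'a::linordered_ab_group_add"
  assumes a: "is_atom a" "L_formula a" and l: "0 < l"
    and v: "v = tm_val c e (lhs a) - tm_val c e (rhs a)" "v' = tm_val c e' (lhs a) - tm_val c e' (rhs a)"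
    and w: "nmul l v = X - \<tau> \<and> nmul l v' = Y - \<tau>' \<or> nmul l v = \<tau> - X \<and> nmul l v' = \<tau>' - Y"
    and le: "X \<le> \<tau> \<longleftrightarrow> Y \<le> \<tau>'" "\<tau> \<le> X \<longleftrightarrow> \<tau>' \<le> Y"
    and cg: "\<And>D. D \<in> atom_groups a \<Longrightarrow> X - \<tau> \<in> D \<longleftrightarrow> Y - \<tau>' \<in> D"
    and cp: "\<And>p D m. p \<in> atom_primes a \<Longrightarrow> D \<in> RJn p oag \<Longrightarrow> m \<le> atom_exponent a + l \<Longrightarrow>
      X - \<tau> \<in> cong_grp D (p ^ m) \<longleftrightarrow> Y - \<tau>' \<in> cong_grp D (p ^ m)"
  shows "sat c e a \<longleftrightarrow> sat c e' a"
proof -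
  have le': "v \<le> 0 \<longleftrightarrow> v' \<le> 0" "0 \<le> v \<longleftrightarrow> 0 \<le> v'"
    using w le nmul_le_iff[OF l, of v 0] nmul_le_iff[OF l, of v' 0]
      nmul_le_iff[OF l, of 0 v] nmul_le_iff[OF l, of 0 v'] by auto
  then have eq': "v = 0 \<longleftrightarrow> v' = 0" by (auto simp: order_eq_iff)
  have w_mem: "nmul l v \<in> H \<longleftrightarrow> nmul l v' \<in> H" if "subgrp H" "X - \<tau> \<in> H \<longleftrightarrow> Y - \<tau>' \<in> H" for H
    using w that subgrp_diff_commute[OF that(1)] by metis
  show ?thesis
  proof (cases a)
    case (Eq s t)
    then show ?thesis using eq' v by simp
  next
    case (Le s t)
    then show ?thesis using le'(1) v by simp
  next
    case (Cong D s t)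
    then have cD: "convex_subgrp D" using a(2) convex_subgrp_RJ by auto
    note s = convex_subgrp_subgrp[OF cD]
    have "z \<in> D \<longleftrightarrow> nmul l z \<in> D" for z
      using subgrp_nmul[OF s] convex_subgrp_pure[OF cD _ l] by blast
    then show ?thesis using w_mem[OF s] cg[of D] Cong v by simp
  next
    case (CongPow D p m s t)
    then have p: "prime p" and cD: "convex_subgrp D" and D: "D \<in> RJn p oag"
      using a(2) convex_subgrp_RJn by auto
    obtain r b where lb: "\<not> p dvd b" "l = b * p ^ r" using prime_power_canonical[OF p l] by blast
    \<comment> \<open>The exponent is raised by that of the p-part of l; r < p^r \<le> l gives the
      crude bound used in \<open>cp\<close>.\<close>
    have "r < p ^ r" using prime_gt_1_nat[OF p] by (simp add: power_gt_expt)
    also have "\<dots> \<le> l" using l lb(2) by (cases b) auto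
    finally have "X - \<tau> \<in> cong_grp D (p ^ (m + r)) \<longleftrightarrow> Y - \<tau>' \<in> cong_grp D (p ^ (m + r))"
      using CongPow D by (intro cp) auto
    then have "nmul l v \<in> cong_grp D (p ^ (m + r)) \<longleftrightarrow> nmul l v' \<in> cong_grp D (p ^ (m + r))"
      by (rule w_mem[OF subgrp_cong_grp[OF convex_subgrp_subgrp[OF cD]]])
    then have "v \<in> cong_grp D (p ^ m) \<longleftrightarrow> v' \<in> cong_grp D (p ^ m)"
      using cong_grp_scale[OF cD p lb(1), of r _ m] by (simp only: lb(2) mult.commute[of b])
    then show ?thesis using CongPow v by (simp only: sat_CongPow_iff lhs.simps rhs.simps)
  qed (use a(1) in auto)
qed

section \<open>Definability from invariance\<close>

definition agree :: "('a set \<Rightarrow> 'a::linordered_ab_group_add) \<Rightarrow> 'a fm set \<Rightarrow> (nat \<Rightarrow> 'a) \<Rightarrow> (nat \<Rightarrow> 'a) \<Rightarrow> bool" where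
  "agree c F e e' \<longleftrightarrow> (\<forall>\<phi>\<in>F. sat c e \<phi> \<longleftrightarrow> sat c e' \<phi>)"

text \<open>Distinguishing the truth value of one formula leaves two properties invariant under the
  remaining ones. For empty F the property is constant, so testing it at a single assignment decides
  it.\<close>

lemma definable_of_invariant:
  assumes "finite F" "\<And>\<phi>. \<phi> \<in> F \<Longrightarrow> L_formula \<phi> \<and> quantifier_free \<phi> \<and> free_vars \<phi> \<subseteq> V"
    and "\<And>e e'. agree c F e e' \<Longrightarrow> Pr e \<longleftrightarrow> Pr e'"
  shows "\<exists>\<psi>. L_formula \<psi> \<and> quantifier_free \<psi> \<and> free_vars \<psi> \<subseteq> V \<and> (\<forall>e. Pr e \<longleftrightarrow> sat c e \<psi>)"
  using assms
proof (induction F arbitrary: Pr rule: finite_induct)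
  case empty
  then have "Pr e \<longleftrightarrow> Pr (\<lambda>_. 0)" for e by (auto simp: agree_def)
  then show ?case
    by (intro exI[of _ "if Pr (\<lambda>_. 0) then Eq Zero Zero else Neg (Eq Zero Zero)"]) auto
next
  case (insert \<phi> F)
  \<comment> \<open>\<open>Q b\<close> closes Pr, restricted to assignments giving \<phi> the truth
    value b, under agreement on F; this forces the invariance that the induction hypothesis asks
    for.\<close>
  define Q where "Q b e \<longleftrightarrow> (\<exists>e0. (sat c e0 \<phi> \<longleftrightarrow> b) \<and> agree c F e e0 \<and> Pr e0)" for b e
  have F: "\<And>\<phi>. \<phi> \<in> F \<Longrightarrow> L_formula \<phi> \<and> quantifier_free \<phi> \<and> free_vars \<phi> \<subseteq> V" using insert.prems(1) by simp
  have "Q b e \<longleftrightarrow> Q b e'" if "agree c F e e'" for b e e'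
  proof -
    have "agree c F e e0 \<longleftrightarrow> agree c F e' e0" for e0 using that by (simp add: agree_def)
    then show ?thesis by (simp add: Q_def)
  qed
  from insert.IH[OF F this]
  have "\<exists>\<psi>. L_formula \<psi> \<and> quantifier_free \<psi> \<and> free_vars \<psi> \<subseteq> V \<and> (\<forall>e. Q b e \<longleftrightarrow> sat c e \<psi>)" for b .
  then obtain \<psi> where \<psi>: "\<And>b. L_formula (\<psi> b) \<and> quantifier_free (\<psi> b) \<and> free_vars (\<psi> b) \<subseteq> V"
    "\<And>b e. Q b e \<longleftrightarrow> sat c e (\<psi> b)" by metis
  have "Pr e \<longleftrightarrow> Q (sat c e \<phi>) e" for e
  proof
    show "Q (sat c e \<phi>) e" if "Pr e" using that by (auto simp: Q_def agree_def)
    assume "Q (sat c e \<phi>) e"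
    then obtain e0 where "sat c e0 \<phi> \<longleftrightarrow> sat c e \<phi>" "agree c F e e0" "Pr e0" by (auto simp: Q_def)
    then have "agree c (insert \<phi> F) e e0" by (auto simp: agree_def)
    then show "Pr e" using insert.prems(2) \<open>Pr e0\<close> by blast
  qed
  then have "Pr e \<longleftrightarrow> (sat c e \<phi> \<and> sat c e (\<psi> True)) \<or> (\<not> sat c e \<phi> \<and> sat c e (\<psi> False))" for e
    using \<psi>(2) by (cases "sat c e \<phi>") auto
  then show ?case
    using \<psi>(1) insert.prems(1)[of \<phi>]
    by (intro exI[of _ "Neg (Conj (Neg (Conj \<phi> (\<psi> True))) (Neg (Conj (Neg \<phi>) (\<psi> False))))"]) auto
qed

text \<open>The absolute value of A - B, where A and B are the coefficients of the variable after
  negative occurrences are moved across; with truncated subtraction one summand is 0.\<close>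

definition coeff_diff :: "nat \<Rightarrow> 'a fm \<Rightarrow> nat" where
  "coeff_diff i a =
     (let A = fst (occurrences i (lhs a)) + snd (occurrences i (rhs a));
          B = snd (occurrences i (lhs a)) + fst (occurrences i (rhs a)) in (A - B) + (B - A))"

text \<open>What N x is compared with once the atom is multiplied by
  \<open>N div coeff_diff i a\<close>; the sign is chosen so that the comparison is with N x and not
  with -N x.\<close>

definition solution :: "nat \<Rightarrow> nat \<Rightarrow> 'a fm \<Rightarrow> 'a tm" where
  "solution N i a =
     (let A = fst (occurrences i (lhs a)) + snd (occurrences i (rhs a));
          B = snd (occurrences i (lhs a)) + fst (occurrences i (rhs a));
          s = erase i (lhs a); t = erase i (rhs a) in
      smult (N div coeff_diff i a) (if B < A then Plus t (Minus s) else Plus s (Minus t)))"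

lemma coeff_diff_eq_0_iff:
  "coeff_diff i a = 0 \<longleftrightarrow> fst (occurrences i (lhs a)) + snd (occurrences i (rhs a)) =
      snd (occurrences i (lhs a)) + fst (occurrences i (rhs a))"
  by (auto simp: coeff_diff_def Let_def)

text \<open>The disjunction stands outside the quantifiers: the sign depends on the atom alone and
  is therefore common to any two assignments.\<close>

lemma solution_spec:
  fixes c :: "'a set \<Rightarrow> 'a::linordered_ab_group_add"
  assumes k: "coeff_diff i a \<noteq> 0" "coeff_diff i a dvd N"
  shows "(\<forall>e x. nmul (N div coeff_diff i a) (tm_val c (e(i := x)) (lhs a) - tm_val c (e(i := x)) (rhs a)) =
       nmul N x - tm_val c e (solution N i a)) \<or>
     (\<forall>e x. nmul (N div coeff_diff i a) (tm_val c (e(i := x)) (lhs a) - tm_val c (e(i := x)) (rhs a)) =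
       tm_val c e (solution N i a) - nmul N x)"
proof -
  define A where "A = fst (occurrences i (lhs a)) + snd (occurrences i (rhs a))"
  define B where "B = snd (occurrences i (lhs a)) + fst (occurrences i (rhs a))"
  define k where "k = coeff_diff i a"
  define l where "l = N div k"
  have N: "N = l * k" using assms by (simp add: l_def k_def)
  have Nx: "nmul N x = nmul l (nmul k x)" for x :: 'a by (simp only: N nmul_mult)
  have kAB: "k = (A - B) + (B - A)" by (simp add: k_def coeff_diff_def A_def B_def Let_def)
  define s where "s = erase i (lhs a)"
  define t where "t = erase i (rhs a)"
  have diff: "tm_val c (e(i := x)) (lhs a) - tm_val c (e(i := x)) (rhs a) =
      nmul A x - nmul B x + (tm_val c e s - tm_val c e t)" for e x
    by (simp add: tm_val_erase A_def B_def s_def t_def nmul_add_left algebra_simps)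
  have sol: "solution N i a = smult l (if B < A then Plus t (Minus s) else Plus s (Minus t))"
    by (simp add: solution_def A_def B_def s_def t_def l_def k_def Let_def)
  show ?thesis
  proof (cases "B < A")
    case True
    then have "A = B + k" using kAB by simp
    then have "nmul l (nmul A x - nmul B x + (tm_val c e s - tm_val c e t)) =
        nmul N x - tm_val c e (solution N i a)" for e x
      using True by (simp add: sol tm_val_smult nmul_add_left Nx nmul_add nmul_minus nmul_diff algebra_simps)
    then show ?thesis unfolding diff k_def[symmetric] l_def[symmetric] by blast
  next
    case False
    then have "B = A + k" using kAB by simp
    then have "nmul l (nmul A x - nmul B x + (tm_val c e s - tm_val c e t)) =
        tm_val c e (solution N i a) - nmul N x" for e x
      using False by (simp add: sol tm_val_smult nmul_add_left Nx nmul_add nmul_minus nmul_diff algebra_simps)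
    then show ?thesis unfolding diff k_def[symmetric] l_def[symmetric] by blast
  qed
qed

lemma L_term_solution: "is_atom a \<Longrightarrow> L_formula a \<Longrightarrow> L_term (solution N i a)"
  by (cases a) (auto simp: solution_def Let_def intro!: L_term_smult L_term_erase)

lemma tm_vars_solution: "is_atom a \<Longrightarrow> tm_vars (solution N i a) \<subseteq> free_vars a - {i}"
  unfolding solution_def Let_def
  by (rule order_trans[OF tm_vars_smult]) (cases a; auto simp: tm_vars_erase)

lemma erase_atom_ok:
  "is_atom a \<Longrightarrow> L_formula a \<Longrightarrow>
    L_formula (erase_atom i a) \<and> quantifier_free (erase_atom i a) \<and> free_vars (erase_atom i a) \<subseteq> free_vars a - {i}"
  by (cases a) (auto simp: L_term_erase tm_vars_erase)


section \<open>Quantifier elimination\<close>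

text \<open>The single point N x replaces the occurrences of x with their different coefficients.
  \<open>extend_point\<close> answers with some Y, which must be divisible by N to yield y; primes
  and exponents are chosen with this in view.\<close>

lemma back_and_forth:
  fixes c :: "'a::linordered_ab_group_add set \<Rightarrow> 'a"
  assumes brr: "bounded_regular_rank (oag :: 'a ord_group)" and ic: "interprets_constants c"
    and F: "finite F" "\<And>a. a \<in> F \<Longrightarrow> is_atom a \<and> L_formula a"
  obtains F' where "finite F'"
    "\<And>\<phi>. \<phi> \<in> F' \<Longrightarrow> L_formula \<phi> \<and> quantifier_free \<phi> \<and> free_vars \<phi> \<subseteq> (\<Union>a\<in>F. free_vars a) - {i}"
    "\<And>e e' x. agree c F' e e' \<Longrightarrow> \<exists>y. agree c F (e(i := x)) (e'(i := y))"
proof (cases "\<forall>x::'a. x = 0")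
  case True
  then have "e(i := x) = e'(i := x)" for e e' :: "nat \<Rightarrow> 'a" and x by (auto simp: fun_eq_iff) (metis True)+
  then have "agree c F (e(i := x)) (e'(i := x))" for e e' x by (metis agree_def)
  then show thesis using that[of "{}"] by blast
next
  case False
  then obtain g :: 'a where g: "g \<noteq> 0" by blast
  define V where "V = (\<Union>a\<in>F. free_vars a) - {i}"
  define F1 where "F1 = {a \<in> F. coeff_diff i a \<noteq> 0}"
  define N where "N = (\<Prod>a\<in>F1. coeff_diff i a)"
  \<comment> \<open>The prime 2 makes P nonempty, so that \<open>{0}\<close> lies in S; the prime
    factors of N serve to divide Y by N.\<close>
  define P where "P = insert 2 (prime_factors N \<union> (\<Union>a\<in>F. atom_primes a))"
  define S where "S = (\<Union>p\<in>P. RJn p oag) \<union> (\<Union>a\<in>F. atom_groups a)"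
  \<comment> \<open>The exponents needed are \<open>atom_exponent a + l\<close> with l \<le> N, and
    those m with p^m dividing N, for which m < p^m \<le> N.\<close>
  define M where "M = (\<Sum>a\<in>F. atom_exponent a) + N"
  define n where "n = (\<Prod>p\<in>P. p ^ M)"
  \<comment> \<open>\<open>Zero\<close> makes T nonempty and turns divisibility of N x into a
    congruence with a parameter.\<close>
  define T where "T = insert Zero (solution N i ` F1)"
  define T' where "T' = T \<union> (\<lambda>(t, D, j). Plus t (smult j (One D))) `
     (T \<times> {D \<in> S. discrete_group (oquot oag D)} \<times> {..n + 2})"
  define F' where "F' = erase_atom i ` (F - F1) \<union> (\<lambda>(s, t). Le s t) ` (T' \<times> T') \<union>
     (\<lambda>(D, s, t). Cong D s t) ` (S \<times> T' \<times> T') \<union>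
     (\<Union>p\<in>P. (\<lambda>(D, m, s, t). CongPow D p m s t) ` (RJn p oag \<times> {1..M} \<times> T' \<times> T'))"
  have "finite F1" using F(1) by (simp add: F1_def)
  have N0: "0 < N" unfolding N_def by (intro prod_pos) (auto simp: F1_def)
  have P_prime: "prime p" if "p \<in> P" for p
  proof -
    have "prime p" if "a \<in> F" "p \<in> atom_primes a" for a
      using F(2)[OF that(1)] that(2) by (cases a) auto
    then show ?thesis using that by (auto simp: P_def)
  qed
  have fin_primes: "finite (atom_primes a)" and fin_groups: "finite (atom_groups a)" for a :: "'a fm"
    by (cases a; simp)+
  have P_fin: "finite P" using F(1) fin_primes by (simp add: P_def)
  have RJ_fin: "finite (RJn p (oag :: 'a ord_group))" if "p \<in> P" for p
    using brr P_prime[OF that] by (simp add: bounded_regular_rank_def)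
  have S_fin: "finite S" unfolding S_def using P_fin RJ_fin F(1) fin_groups by blast
  have RJn_RJ: "RJn p oag \<subseteq> (RJ oag :: 'a set set)" if "p \<in> P" for p
    using prime_ge_2_nat[OF P_prime[OF that]] unfolding RJ_def by blast
  have S_RJ: "D \<in> RJ oag" if "D \<in> S" for D
  proof -
    have "D \<in> RJ oag" if "a \<in> F" "D \<in> atom_groups a" for a
      using F(2)[OF that(1)] that(2) by (cases a) auto
    then show ?thesis using \<open>D \<in> S\<close> RJn_RJ unfolding S_def by blast
  qed
  have zero_RJ: "{0} \<in> RJn p (oag :: 'a ord_group)" if "p \<in> P" for p
    using zero_in_RJn[OF RJ_fin[OF that] g] .
  have "2 \<in> P" by (simp add: P_def)
  then have S0: "{0} \<in> S" using zero_RJ[of 2] unfolding S_def by blast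
  have const: "least_positive (oquot oag D) (D #>\<^bsub>oag\<^esub> c D)"
    if "D \<in> S" "discrete_group (oquot oag D)" for D
    using ic S_RJ[OF that(1)] that(2) by (simp add: interprets_constants_def)
  have T_fin: "finite T" using \<open>finite F1\<close> by (simp add: T_def)
  have T'_fin: "finite T'" using T_fin S_fin by (simp add: T'_def)
  have T_ok: "L_term t \<and> tm_vars t \<subseteq> V" if "t \<in> T" for t
  proof -
    have "L_term (solution N i a) \<and> tm_vars (solution N i a) \<subseteq> V" if "a \<in> F1" for a
    proof -
      have a: "a \<in> F" using that by (simp add: F1_def)
      then have "tm_vars (solution N i a) \<subseteq> V"
        using tm_vars_solution[of a N i] F(2)[OF a] unfolding V_def by blast
      then show ?thesis using L_term_solution F(2)[OF a] by blast
    qed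
    then show ?thesis using that by (auto simp: T_def)
  qed
  have T'_ok: "L_term t \<and> tm_vars t \<subseteq> V" if t: "t \<in> T'" for t
  proof -
    have "L_term (Plus s (smult j (One D))) \<and> tm_vars (Plus s (smult j (One D))) \<subseteq> V"
      if "s \<in> T" "D \<in> S" "discrete_group (oquot oag D)" for s j D
      using T_ok[OF that(1)] S_RJ[OF that(2)] that(3) tm_vars_smult[of j "One D"]
      by (auto intro!: L_term_smult)
    moreover have "t \<in> T \<or> (\<exists>s D j. t = Plus s (smult j (One D)) \<and> s \<in> T \<and> D \<in> S \<and> discrete_group (oquot oag D))"
      using t unfolding T'_def by auto
    ultimately show ?thesis using T_ok by metis
  qed
  have F'_fin: "finite F'"
    unfolding F'_def using F(1) T'_fin S_fin P_fin RJ_fin by (intro finite_UnI finite_UN_I finite_imageI finite_cartesian_product) auto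
  have F'_ok: "L_formula \<phi> \<and> quantifier_free \<phi> \<and> free_vars \<phi> \<subseteq> V" if \<phi>: "\<phi> \<in> F'" for \<phi>
  proof -
    have *: "L_formula (erase_atom i a) \<and> quantifier_free (erase_atom i a) \<and> free_vars (erase_atom i a) \<subseteq> V"
      if "a \<in> F" for a
      using erase_atom_ok[of a i] F(2)[OF that] that unfolding V_def by blast
    consider a where "a \<in> F" "\<phi> = erase_atom i a"
      | s t where "s \<in> T'" "t \<in> T'" "\<phi> = Le s t"
      | D s t where "D \<in> S" "s \<in> T'" "t \<in> T'" "\<phi> = Cong D s t"
      | p D m s t where "p \<in> P" "D \<in> RJn p oag" "1 \<le> m" "s \<in> T'" "t \<in> T'" "\<phi> = CongPow D p m s t"
      using \<phi> unfolding F'_def by auto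
    then show ?thesis
    proof cases
      case 1
      then show ?thesis using * by blast
    next
      case 2
      then show ?thesis using T'_ok[OF 2(1)] T'_ok[OF 2(2)] by simp
    next
      case 3
      then show ?thesis using T'_ok[OF 3(2)] T'_ok[OF 3(3)] S_RJ[OF 3(1)] by simp
    next
      case 4
      then show ?thesis using T'_ok[OF 4(4)] T'_ok[OF 4(5)] P_prime[OF 4(1)] by simp
    qed
  qed
  have "\<exists>y. agree c F (e(i := x)) (e'(i := y))" if ag: "agree c F' e e'" for e e' x
  proof -
    have RJn_S: "RJn p oag \<subseteq> S" if "p \<in> P" for p using that unfolding S_def by blast
    let ?u = "tm_val c e" and ?u' = "tm_val c e'"
    have le: "?u s \<le> ?u t \<longleftrightarrow> ?u' s \<le> ?u' t" if "s \<in> T'" "t \<in> T'" for s t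
    proof -
      have "Le s t \<in> (\<lambda>(s, t). Le s t) ` (T' \<times> T')"
        by (rule rev_image_eqI[of "(s, t)"]) (use that in simp_all)
      then have "Le s t \<in> F'" unfolding F'_def by (rule UnI1[OF UnI1[OF UnI2]])
      then show ?thesis using ag by (fastforce simp: agree_def)
    qed
    have cg: "?u s - ?u t \<in> D \<longleftrightarrow> ?u' s - ?u' t \<in> D" if "s \<in> T'" "t \<in> T'" "D \<in> S" for s t D
    proof -
      have "Cong D s t \<in> (\<lambda>(D, s, t). Cong D s t) ` (S \<times> T' \<times> T')"
        by (rule rev_image_eqI[of "(D, s, t)"]) (use that in simp_all)
      then have "Cong D s t \<in> F'" unfolding F'_def by (rule UnI1[OF UnI2])
      then show ?thesis using ag by (fastforce simp: agree_def)
    qed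
    have cp: "?u s - ?u t \<in> cong_grp D (p ^ m) \<longleftrightarrow> ?u' s - ?u' t \<in> cong_grp D (p ^ m)"
      if "s \<in> T'" "t \<in> T'" "p \<in> P" "D \<in> RJn p oag" "m \<le> M" for s t p D m
    \<comment> \<open>Exponent 0 is outside the language, but the congruence is then
      trivial.\<close>
    proof (cases "m = 0")
      case True
      then show ?thesis using convex_subgrp_subgrp[OF convex_subgrp_RJn[OF that(4)]] by simp
    next
      case False
      then have "CongPow D p m s t \<in>
          (\<lambda>(D, m, s, t). CongPow D p m s t) ` (RJn p oag \<times> {1..M} \<times> T' \<times> T')"
        by (intro rev_image_eqI[of "(D, m, s, t)"]) (use that in simp_all)
      then have "CongPow D p m s t \<in> F'" unfolding F'_def by (rule UnI2[OF UN_I[OF that(3)]])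
      then show ?thesis using ag unfolding agree_def sat_CongPow_iff[symmetric] by blast
    qed
    have TT': "T \<subseteq> T'" "T \<noteq> {}" by (auto simp: T'_def T_def)
    have shift: "\<exists>s\<in>T'. ?u s = ?u t + nmul j (c D) \<and> ?u' s = ?u' t + nmul j (c D)"
      if "t \<in> T" "D \<in> S" "discrete_group (oquot oag D)" "j \<le> n + 2" for t D j
    proof -
      have "(t, D, j) \<in> T \<times> {D \<in> S. discrete_group (oquot oag D)} \<times> {..n + 2}" using that by simp
      then have "Plus t (smult j (One D)) \<in> T'"
        unfolding T'_def by (intro UnI2 rev_image_eqI[of "(t, D, j)"]) simp_all
      then show ?thesis by (intro bexI[of _ "Plus t (smult j (One D))"]) (simp_all add: tm_val_smult)
    qed
    obtain Y where Y: "\<And>t. t \<in> T \<Longrightarrow> nmul N x \<le> ?u t \<longleftrightarrow> Y \<le> ?u' t"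
      "\<And>t. t \<in> T \<Longrightarrow> ?u t \<le> nmul N x \<longleftrightarrow> ?u' t \<le> Y"
      "\<And>t D. t \<in> T \<Longrightarrow> D \<in> S \<Longrightarrow> nmul N x - ?u t \<in> D \<longleftrightarrow> Y - ?u' t \<in> D"
      "\<And>t p D m. t \<in> T \<Longrightarrow> p \<in> P \<Longrightarrow> D \<in> RJn p oag \<Longrightarrow> m \<le> M \<Longrightarrow>
        nmul N x - ?u t \<in> cong_grp D (p ^ m) \<longleftrightarrow> Y - ?u' t \<in> cong_grp D (p ^ m)"
      by (rule extend_point[OF S_fin S0 convex_subgrp_RJ[OF S_RJ] P_fin P_prime RJn_S n_def const T'_fin TT'
            shift le cg cp, where x = "nmul N x"]) (assumption+, rule that)
    \<comment> \<open>N x is congruent to 0 modulo p^m G whenever p^m divides N; this carries over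
      to Y.\<close>
    have "Y \<in> cong_grp {0} N"
    proof (rule cong_grp_zero_prime_powers[OF N0])
      fix p m assume p: "prime p" "p ^ m dvd N"
      show "Y \<in> cong_grp {0} (p ^ m)"
      proof (cases "m = 0")
        case True
        then show ?thesis by (simp add: cong_grp_zero_iff)
      next
        case False
        then have "p dvd N" using p(2) by (metis dvd_power dvd_trans neq0_conv)
        then have pP: "p \<in> P" using p(1) N0 by (auto simp: P_def prime_factors_dvd)
        have "m < p ^ m" using prime_gt_1_nat[OF p(1)] by (simp add: power_gt_expt)
        also have "\<dots> \<le> N" using p(2) N0 by (rule dvd_imp_le)
        finally have "m \<le> M" by (simp add: M_def)
        moreover have "nmul N x \<in> cong_grp {0} (p ^ m)"
          by (rule subsetD[OF cong_grp_antimono[OF p(2)]]) (auto simp: cong_grp_zero_iff)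
        ultimately show ?thesis using Y(4)[OF _ pP zero_RJ[OF pP], of Zero m] by (simp add: T_def)
      qed
    qed
    then obtain y where y: "Y = nmul N y" by (auto simp: cong_grp_zero_iff)
    have "sat c (e(i := x)) a \<longleftrightarrow> sat c (e'(i := y)) a" if a: "a \<in> F" for a
    proof (cases "a \<in> F1")
      case False
      then have "coeff_diff i a = 0" using a by (simp add: F1_def)
      then have "sat c (e0(i := z)) a \<longleftrightarrow> sat c e0 (erase_atom i a)" for e0 z
        by (rule sat_erase_atom[OF conjunct1[OF F(2)[OF a]] iffD1[OF coeff_diff_eq_0_iff]])
      moreover have "erase_atom i a \<in> F'" using a False unfolding F'_def by blast
      ultimately show ?thesis using ag by (simp add: agree_def)
    next
      case True
      define k where "k = coeff_diff i a"
      have k: "k \<noteq> 0" "k dvd N"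
        using True \<open>finite F1\<close> by (auto simp: k_def F1_def N_def intro!: dvd_prodI)
      define l where "l = N div k"
      have l: "0 < l" "l \<le> N" using k N0 by (auto simp: l_def dvd_div_eq_0_iff)
      have sT: "solution N i a \<in> T" using True by (simp add: T_def)
      show ?thesis
      proof (rule atom_transfer[OF _ _ l(1) refl refl])
        show "is_atom a" "L_formula a" using F(2)[OF a] by auto
        show "nmul l (tm_val c (e(i := x)) (lhs a) - tm_val c (e(i := x)) (rhs a)) = nmul N x - ?u (solution N i a) \<and>
            nmul l (tm_val c (e'(i := y)) (lhs a) - tm_val c (e'(i := y)) (rhs a)) = Y - ?u' (solution N i a) \<or>
            nmul l (tm_val c (e(i := x)) (lhs a) - tm_val c (e(i := x)) (rhs a)) = ?u (solution N i a) - nmul N x \<and>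
            nmul l (tm_val c (e'(i := y)) (lhs a) - tm_val c (e'(i := y)) (rhs a)) = ?u' (solution N i a) - Y"
          using solution_spec[OF k[unfolded k_def], where c = c] unfolding y l_def k_def by blast
        show "nmul N x \<le> ?u (solution N i a) \<longleftrightarrow> Y \<le> ?u' (solution N i a)"
          "?u (solution N i a) \<le> nmul N x \<longleftrightarrow> ?u' (solution N i a) \<le> Y" using Y(1,2)[OF sT] .
        show "nmul N x - ?u (solution N i a) \<in> D \<longleftrightarrow> Y - ?u' (solution N i a) \<in> D" if "D \<in> atom_groups a" for D
          using Y(3)[OF sT] that a unfolding S_def by blast
        show "nmul N x - ?u (solution N i a) \<in> cong_grp D (p ^ m) \<longleftrightarrow> Y - ?u' (solution N i a) \<in> cong_grp D (p ^ m)"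
          if "p \<in> atom_primes a" "D \<in> RJn p oag" "m \<le> atom_exponent a + l" for p D m
        proof (rule Y(4)[OF sT _ that(2)])
          show "p \<in> P" using that(1) a unfolding P_def by blast
          have "atom_exponent a \<le> (\<Sum>a\<in>F. atom_exponent a)" using a F(1) by (intro member_le_sum) auto
          then show "m \<le> M" using that(3) l(2) by (simp add: M_def)
        qed
      qed
    qed
    then show ?thesis unfolding agree_def by blast
  qed
  then show thesis using that[OF F'_fin F'_ok[unfolded V_def]] by blast
qed

theorem theorem2p4:
  fixes c :: "'a::linordered_ab_group_add set \<Rightarrow> 'a"
  assumes "bounded_regular_rank (oag :: 'a ord_group)"
    and "interprets_constants c"
  shows "admits_QE c"
proof -
  have "\<exists>\<psi>. L_formula \<psi> \<and> quantifier_free \<psi> \<and> free_vars \<psi> \<subseteq> free_vars \<phi> \<and> (\<forall>e. sat c e \<phi> \<longleftrightarrow> sat c e \<psi>)"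
    if "L_formula \<phi>" for \<phi>
    using that
  proof (induction \<phi>)
    case (Neg \<phi>)
    then obtain \<psi> where "L_formula \<psi>" "quantifier_free \<psi>" "free_vars \<psi> \<subseteq> free_vars \<phi>"
      "\<forall>e. sat c e \<phi> \<longleftrightarrow> sat c e \<psi>" by auto
    then show ?case by (intro exI[of _ "Neg \<psi>"]) simp
  next
    case (Conj \<phi>1 \<phi>2)
    then obtain \<psi>1 \<psi>2 where
      "L_formula \<psi>1" "quantifier_free \<psi>1" "free_vars \<psi>1 \<subseteq> free_vars \<phi>1" "\<forall>e. sat c e \<phi>1 \<longleftrightarrow> sat c e \<psi>1"
      "L_formula \<psi>2" "quantifier_free \<psi>2" "free_vars \<psi>2 \<subseteq> free_vars \<phi>2" "\<forall>e. sat c e \<phi>2 \<longleftrightarrow> sat c e \<psi>2"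
      by auto
    then show ?case by (intro exI[of _ "Conj \<psi>1 \<psi>2"]) auto
  next
    case (Ex i \<phi>)
    then obtain \<psi> where \<psi>: "L_formula \<psi>" "quantifier_free \<psi>" "free_vars \<psi> \<subseteq> free_vars \<phi>"
      "\<forall>e. sat c e \<phi> \<longleftrightarrow> sat c e \<psi>" by auto
    have atoms_ok: "is_atom a \<and> L_formula a" if "a \<in> atoms \<psi>" for a
      using that \<psi>(1) is_atom_atoms L_formula_atoms by blast
    obtain F' where F': "finite F'"
      "\<And>\<chi>. \<chi> \<in> F' \<Longrightarrow> L_formula \<chi> \<and> quantifier_free \<chi> \<and> free_vars \<chi> \<subseteq> (\<Union>a\<in>atoms \<psi>. free_vars a) - {i}"
      "\<And>e e' x. agree c F' e e' \<Longrightarrow> \<exists>y. agree c (atoms \<psi>) (e(i := x)) (e'(i := y))"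
      using back_and_forth[OF assms finite_atoms[of \<psi>] atoms_ok, of i] by metis
    have step: "\<exists>y. sat c (e'(i := y)) \<psi>" if ag: "agree c F' e e'" and ex: "\<exists>x. sat c (e(i := x)) \<psi>" for e e'
    proof -
      obtain x where "sat c (e(i := x)) \<psi>" using ex by blast
      moreover obtain y where "agree c (atoms \<psi>) (e(i := x)) (e'(i := y))" using F'(3)[OF ag] by blast
      ultimately show ?thesis using sat_atoms_cong[OF \<psi>(2)] unfolding agree_def by blast
    qed
    have "(\<Union>a\<in>atoms \<psi>. free_vars a) - {i} \<subseteq> free_vars (Ex i \<phi>)"
      using free_vars_atoms[OF \<psi>(2)] \<psi>(3) by fastforce
    then have "\<exists>\<chi>. L_formula \<chi> \<and> quantifier_free \<chi> \<and> free_vars \<chi> \<subseteq> free_vars (Ex i \<phi>) \<and>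
        (\<forall>e. (\<exists>x. sat c (e(i := x)) \<psi>) \<longleftrightarrow> sat c e \<chi>)"
    proof (intro definable_of_invariant[OF F'(1)])
      fix e e' assume ag: "agree c F' e e'"
      \<comment> \<open>Agreement is symmetric, so extending in one direction yields both
        implications.\<close>
      then have "agree c F' e' e" by (simp add: agree_def)
      then show "(\<exists>x. sat c (e(i := x)) \<psi>) \<longleftrightarrow> (\<exists>x. sat c (e'(i := x)) \<psi>)"
        using step ag by blast
    qed (use F'(2) in blast)
    then show ?case using \<psi>(4) by simp
  next
    case (Eq s t)
    then show ?case by (intro exI[of _ "Eq s t"]) simp
  next
    case (Le s t)
    then show ?case by (intro exI[of _ "Le s t"]) simp
  next
    case (Cong D s t)
    then show ?case by (intro exI[of _ "Cong D s t"]) simp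
  next
    case (CongPow D p m s t)
    then show ?case by (intro exI[of _ "CongPow D p m s t"]) (simp only: L_formula.simps quantifier_free.simps, simp)
  qed
  then show ?thesis unfolding admits_QE_def by blast
qed

end
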